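(* Let $I\subset\hat{\mathcal O}=\mathbb C[[x_1,\ldots,x_n]]$ be any ideal. Then the following subsets of $\mathcal U_{\mathrm{loc}}$ coincide: (1) $\{w\in\mathcal U_{\mathrm{loc}}\mid \text{for every } f\in I,\ \mathrm{in}_w(f)\in\mathrm{Gr}^w(\hat{\mathcal O})\text{ is not a monomial}\}$; (2) $\bigcap_{f\in I}\mathcal T^h_{\mathrm{loc}}(\mathrm{trop}(f))$; (3) $\bigcup_{\lambda\in\Lambda}\Bigl(\bigl(\bigcap_{f\in I}\mathcal T^h_{\mathrm{loc}}(\mathrm{trop}(\widetilde f^{\lambda}))\bigr)\cap\mathcal U^{\lambda}_{\mathrm{loc}}\Bigr)$; (4) $\bigcup_{\lambda\in\Lambda}\Bigl(\bigl(\bigcap_{f\in I}\mathcal T^h_{\mathrm{loc}}(\mathrm{trop}(\widehat f^{\lambda}))\bigr)\cap\mathcal U^{\lambda}_{\mathrm{loc}}\Bigr)$; (5) $\bigcup_{\lambda\in\Lambda}\Bigl(\bigl(\bigcap_{f\in I}\overline{\mathrm{ord}(V(\widehat f^{\lambda}))}\bigr)\cap\mathcal U^{\lambda}_{\mathrm{loc}}\Bigr)$.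
   Context: Let $\mathcal U_{\mathrm{loc}}=\{u\in\mathbb R^n\mid u_i\ge 0\ \forall i\}$. For $f=\sum_\alpha p_\alpha x^\alpha\in\hat{\mathcal O}$ put $\mathrm{Supp}(f)=\{\alpha\in\mathbb N^n\mid p_\alpha\ne0\}$. For $u\in\mathcal U_{\mathrm{loc}}$, $\mathrm{wei}^u(f)=\min_{\alpha\in\mathrm{Supp}(f)}u\cdot\alpha$, $F^u_k=\{f\mid \mathrm{wei}^u(f)\ge k\}$, $F^u_{>k}=\{f\mid\mathrm{wei}^u(f)>k\}$, $\mathrm{Gr}^u(\hat{\mathcal O})=\bigoplus_k F^u_k/F^u_{>k}$, and $\mathrm{in}_u(f)$ is the class of $f$ in $F^u_k/F^u_{>k}$ with $k=\mathrm{wei}^u(f)$ (and $\mathrm{in}_u(0)=0$). $\mathrm{Gr}^u(\hat{\mathcal O})$ is identified with a subring of $\hat{\mathcal O}$, so that $\mathrm{in}_u(f)$ is the sum of the terms $p_\alpha x^\alpha$ of $f$ with $u\cdot\alpha=\mathrm{wei}^u(f)$. A monomial is an element $c\,x^\alpha$ with $c\in\mathbb C\setminus\{0\}$. $\mathrm{trop}(f)$ is the function $w\mapsto\min_{\alpha\in\mathrm{Supp}(f)}w\cdot\alpha$ (the possibly infinite tropical sum of the tropical monomials $0\odot x^{\alpha}$, $\alpha\in\mathrm{Supp}(f)$), and $\mathcal T^h_{\mathrm{loc}}(\mathrm{trop}(f))$ is the set of $w\in\mathcal U_{\mathrm{loc}}$ at which this minimum is attained by at least two distinct $\alpha\in\mathrm{Supp}(f)$;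 for $f=0$ it is all of $\mathcal U_{\mathrm{loc}}$. Strata: $\Lambda=\{0,1,\ldots,n,12,13,\ldots,123\cdots n\}$ indexes all subsets $J\subset\{1,\ldots,n\}$ ($\lambda=0$ corresponds to $J=\emptyset$, otherwise $\lambda$ lists the elements of $J$), and $\mathcal U^\lambda_{\mathrm{loc}}=\{u\in\mathbb R^n\mid u_j=0\text{ for }j\in J,\ u_i>0\text{ for }i\notin J\}$. Definition of $\widetilde f^\lambda,\widehat f^\lambda$ for $f=\sum_\alpha p_\alpha x^\alpha$. For $J\ne\{1,\ldots,n\}$ let $\pi_J:\mathbb N^n\to\mathbb N^{\{1,\ldots,n\}\setminus J}$ be the projection forgetting the coordinates in $J$, and let $\{\beta^1,\ldots,\beta^l\}$ be the finite minimal subset of $\pi_J(\mathrm{Supp}(f))$ with $\{\beta^1,\ldots,\beta^l\}+\mathbb N^{\{1,\ldots,n\}\setminus J}=\pi_J(\mathrm{Supp}(f))+\mathbb N^{\{1,\ldots,n\}\setminus J}$. Put $E^i=\{\alpha\in\mathrm{Supp}(f)\mid\pi_J(\alpha)=\beta^i\}$ and $\widetilde f^\lambda=\sum_{\alpha\in E^1\cup\cdots\cup E^l}p_\alpha x^\alpha\in\hat{\mathcal O}$. If $\sharp E^i=1$ let $A^i=E^i$; if $\sharp E^i\ge2$ let $A^i$ be a chosen two-element subset of $E^i$. Put $\widehat f^\lambda=\sum_{\alpha\in A^1\cup\cdots\cup A^l}p_\alpha x^\alpha\in\mathbb C[x_1,\ldots,x_n]$. (For $\lambda=0$, $\widetilde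 f^0=\widehat f^0$.) For $J=\{1,\ldots,n\}$, $\widetilde f^\lambda=\widehat f^\lambda=0$. The choices are made once for each $f$ and $\lambda$. Let $K=\mathbb C\{\{t\}\}$ be the field of Puiseux series. For a polynomial $g\in\mathbb C[x]$, $V(g)=V(\langle g\rangle)=\{v\in(K\setminus\{0\})^n\mid g(v)=0\}$; $\mathrm{ord}:(K\setminus\{0\})^n\to\mathbb Q^n\subset\mathbb R^n$ takes each coordinate to its order (lowest exponent), and the overline denotes topological closure in $\mathbb R^n$.
   Formalization: If I contains a monomial (e.g. I = (1)), sets (1) and (2) are empty while (3), (4), (5) contain the origin; so (2) = (3) is proved away from the origin for every ideal, and in full when I contains no monomial. The other equalities hold for every ideal. *)

theory Defs
  imports "HOL-Analysis.Analysis" "HOL-Algebra.Ideal"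
    "HOL-Computational_Algebra.Formal_Laurent_Series"
begin

no_notation fps_nth (infixl "$" 75)

text \<open>Puiseux series over the complex numbers, \<open>\<Union>m. \<complex>((t\<^bsup>1/m\<^esup>))\<close>, as coefficient functions on rational
  exponents: the exponents that occur have a common denominator \<open>m\<close> and are bounded below.\<close>

definition is_puiseux :: "(rat \<Rightarrow> complex) \<Rightarrow> bool" where
  "is_puiseux f \<longleftrightarrow> (\<exists>m::nat. \<exists>N::int. m > 0 \<and>
      (\<forall>q. f q \<noteq> 0 \<longrightarrow> of_nat m * q \<in> \<int> \<and> of_int N \<le> of_nat m * q))"

lemma is_puiseuxI:
  assumes "m > 0" "\<And>q. f q \<noteq> 0 \<Longrightarrow> of_nat m * q \<in> \<int> \<and> of_int N \<le> of_nat m * q"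
  shows "is_puiseux f"
  using assms unfolding is_puiseux_def by blast

lemma is_puiseuxE:
  assumes "is_puiseux f"
  obtains m N where "m > 0"
    "\<forall>q. f q \<noteq> 0 \<longrightarrow> of_nat m * q \<in> \<int> \<and> of_int N \<le> of_nat m * q"
  using assms unfolding is_puiseux_def by blast

lemma is_puiseuxE2:
  assumes "is_puiseux f" "is_puiseux g"
  obtains m N where "m > 0"
    "\<forall>q. f q \<noteq> 0 \<or> g q \<noteq> 0 \<longrightarrow> of_nat m * q \<in> \<int> \<and> of_int N \<le> of_nat m * q"
proof -
  obtain m N where m: "m > 0" "\<forall>q. f q \<noteq> 0 \<longrightarrow> of_nat m * q \<in> \<int> \<and> of_int N \<le> of_nat m * q"
    using assms(1) by (rule is_puiseuxE)
  obtain k M where k: "k > 0" "\<forall>q. g q \<noteq> 0 \<longrightarrow> of_nat k * q \<in> \<int> \<and> of_int M \<le> of_nat k * q"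
    using assms(2) by (rule is_puiseuxE)
  have "of_nat (m * k) * q \<in> \<int> \<and>
        of_int (min (int k * N) (int m * M)) \<le> of_nat (m * k) * q"
    if "f q \<noteq> 0 \<or> g q \<noteq> 0" for q
  proof -
    from that consider "f q \<noteq> 0" | "g q \<noteq> 0" by blast
    then have "of_nat (m * k) * q \<in> \<int> \<and>
      (of_int (int k * N) \<le> of_nat (m * k) * q \<or> of_int (int m * M) \<le> of_nat (m * k) * q)"
    proof cases
      case 1
      have "of_nat k * (of_nat m * q) \<in> \<int>" using m(2) 1 by (blast intro: Ints_mult Ints_of_nat)
      moreover have "of_nat k * of_int N \<le> of_nat k * (of_nat m * q)"
        using m(2) 1 by (intro mult_left_mono) auto
      ultimately show ?thesis by (simp add: mult_ac)
    next
      case 2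
      have "of_nat m * (of_nat k * q) \<in> \<int>" using k(2) 2 by (blast intro: Ints_mult Ints_of_nat)
      moreover have "of_nat m * of_int M \<le> of_nat m * (of_nat k * q)"
        using k(2) 2 by (intro mult_left_mono) auto
      ultimately show ?thesis by (simp add: mult_ac)
    qed
    then show ?thesis by (auto simp: of_int_min)
  qed
  moreover have "m * k > 0" using m k by simp
  ultimately show ?thesis using that[of "m * k"] by blast
qed

typedef puiseux = "{f. is_puiseux f}"
  morphisms puiseux_coeff Abs_puiseux
  by (rule exI[of _ "\<lambda>_. 0"]) (auto intro: is_puiseuxI[of 1])

setup_lifting type_definition_puiseux

instantiation puiseux :: "{zero, one, plus, minus, uminus, times}"
begin

lift_definition zero_puiseux :: puiseux is "\<lambda>_. 0"
  by (rule is_puiseuxI[of 1]) auto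

lift_definition one_puiseux :: puiseux is "\<lambda>q. if q = 0 then 1 else 0"
  by (rule is_puiseuxI[of 1 _ 0]) (auto split: if_splits)

lift_definition uminus_puiseux :: "puiseux \<Rightarrow> puiseux" is "\<lambda>f q. - f q"
  by (simp add: is_puiseux_def)

lift_definition plus_puiseux :: "puiseux \<Rightarrow> puiseux \<Rightarrow> puiseux" is "\<lambda>f g q. f q + g q"
proof -
  fix f g :: "rat \<Rightarrow> complex"
  assume "is_puiseux f" "is_puiseux g"
  then obtain m N where m: "m > 0"
    "\<forall>q. f q \<noteq> 0 \<or> g q \<noteq> 0 \<longrightarrow> of_nat m * q \<in> \<int> \<and> of_int N \<le> of_nat m * q"
    by (rule is_puiseuxE2)
  show "is_puiseux (\<lambda>q. f q + g q)"
    using m(1)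
    by (rule is_puiseuxI[of _ _ N]) (use m(2) in \<open>metis add.right_neutral\<close>)
qed

lift_definition times_puiseux :: "puiseux \<Rightarrow> puiseux \<Rightarrow> puiseux" is
  "\<lambda>f g q. \<Sum>a | f a \<noteq> 0 \<and> g (q - a) \<noteq> 0. f a * g (q - a)"
proof -
  fix f g :: "rat \<Rightarrow> complex"
  assume "is_puiseux f" "is_puiseux g"
  then obtain m N where m: "m > 0"
    "\<forall>q. f q \<noteq> 0 \<or> g q \<noteq> 0 \<longrightarrow> of_nat m * q \<in> \<int> \<and> of_int N \<le> of_nat m * q"
    by (rule is_puiseuxE2)
  show "is_puiseux (\<lambda>q. \<Sum>a | f a \<noteq> 0 \<and> g (q - a) \<noteq> 0. f a * g (q - a))"
    using m(1)
  proof (rule is_puiseuxI)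
    fix q assume nz: "(\<Sum>a | f a \<noteq> 0 \<and> g (q - a) \<noteq> 0. f a * g (q - a)) \<noteq> 0"
    obtain a where a: "f a \<noteq> 0" "g (q - a) \<noteq> 0"
      using sum.not_neutral_contains_not_neutral[OF nz] by auto
    have "of_nat m * a + of_nat m * (q - a) \<in> \<int>"
      using spec[OF m(2), of a] spec[OF m(2), of "q - a"] a by (intro Ints_add) auto
    moreover have "of_int N + of_int N \<le> of_nat m * a + of_nat m * (q - a)"
      using spec[OF m(2), of a] spec[OF m(2), of "q - a"] a by (intro add_mono) auto
    ultimately show "of_nat m * q \<in> \<int> \<and> of_int (N + N) \<le> of_nat m * q"
      by (simp add: algebra_simps)
  qed
qed

definition minus_puiseux :: "puiseux \<Rightarrow> puiseux \<Rightarrow> puiseux" where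
  "minus_puiseux f g = f + - g"

instance ..

end

text \<open>\<open>ramify m F\<close> is the Puiseux series \<open>F(t\<^bsup>1/m\<^esup>)\<close>; it carries the field axioms over
  from formal Laurent series.\<close>

lift_definition ramify :: "nat \<Rightarrow> complex fls \<Rightarrow> puiseux" is
  "\<lambda>m F (q::rat). if m > 0 \<and> of_nat m * q \<in> \<int> then fls_nth F \<lfloor>of_nat m * q\<rfloor> else 0"
proof -
  fix m and F :: "complex fls"
  show "is_puiseux (\<lambda>q. if m > 0 \<and> of_nat m * q \<in> \<int> then fls_nth F \<lfloor>of_nat m * q\<rfloor> else 0)"
  proof (cases "m > 0")
    case True
    then show ?thesis
    proof (rule is_puiseuxI[of _ _ "fls_subdegree F"])
      fix q :: rat
      assume "(if m > 0 \<and> of_nat m * q \<in> \<int> then fls_nth F \<lfloor>of_nat m * q\<rfloor> else 0) \<noteq> 0"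
      then have "of_nat m * q \<in> \<int>" "fls_nth F \<lfloor>of_nat m * q\<rfloor> \<noteq> 0" by (auto split: if_splits)
      moreover from this(2) have "fls_subdegree F \<le> \<lfloor>of_nat m * q\<rfloor>" by (rule fls_subdegree_leI)
      ultimately show "of_nat m * q \<in> \<int> \<and> of_int (fls_subdegree F) \<le> of_nat m * q"
        by (simp add: le_floor_iff)
    qed
  next
    case False
    then show ?thesis by (auto intro: is_puiseuxI[of 1])
  qed
qed

lemma puiseux_eqI: "(\<And>q. puiseux_coeff f q = puiseux_coeff g q) \<Longrightarrow> f = g"
  by (simp add: puiseux_coeff_inject[symmetric] fun_eq_iff)

lemma ramify_nth:
  "m > 0 \<Longrightarrow> puiseux_coeff (ramify m F) (of_int k / of_nat m) = fls_nth F k"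
  by (simp add: ramify.rep_eq)

lemma puiseux_ramifyE:
  obtains m F where "m > 0" "p = ramify m F"
proof -
  have "is_puiseux (puiseux_coeff p)" using puiseux_coeff[of p] by simp
  then obtain m N where m: "m > 0"
    "\<forall>q. puiseux_coeff p q \<noteq> 0 \<longrightarrow> of_nat m * q \<in> \<int> \<and> of_int N \<le> of_nat m * q"
    by (rule is_puiseuxE)
  define F where "F = Abs_fls (\<lambda>k. puiseux_coeff p (of_int k / of_nat m))"
  have F: "fls_nth F k = puiseux_coeff p (of_int k / of_nat m)" for k
    unfolding F_def
  proof (rule nth_Abs_fls_lower_bound)
    show "\<forall>k<N. puiseux_coeff p (of_int k / of_nat m) = 0"
    proof (intro allI impI, rule ccontr)
      fix k assume "k < N" and nz: "puiseux_coeff p (of_int k / of_nat m) \<noteq> 0"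
      have "(of_int N :: rat) \<le> of_int k" using spec[OF m(2), of "of_int k / of_nat m"] nz m(1) by simp
      with \<open>k < N\<close> show False by simp
    qed
  qed
  have "p = ramify m F"
  proof (rule puiseux_eqI)
    fix q
    show "puiseux_coeff p q = puiseux_coeff (ramify m F) q"
    proof (cases "of_nat m * q \<in> \<int>")
      case True
      then obtain k where k: "of_nat m * q = of_int k" by (auto elim: Ints_cases)
      then have "q = of_int k / of_nat m" using m(1) by (simp add: field_simps)
      then show ?thesis using m(1) by (simp only: ramify_nth F)
    next
      case False
      then show ?thesis using spec[OF m(2), of q] by (auto simp: ramify.rep_eq)
    qed
  qed
  with m(1) show ?thesis by (rule that)
qed

lemma ramify_refine:
  assumes "m > 0" "k > 0"
  shows "ramify (m * k) (fls_compose_power F k) = ramify m F"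
proof (rule puiseux_eqI)
  fix q
  show "puiseux_coeff (ramify (m * k) (fls_compose_power F k)) q = puiseux_coeff (ramify m F) q"
  proof (cases "of_nat m * q \<in> \<int>")
    case True
    then obtain j where j: "of_nat m * q = of_int j" by (auto elim: Ints_cases)
    then have "of_nat (m * k) * q = of_int (int k * j)" by (simp add: mult_ac)
    moreover have "\<lfloor>of_nat (m * k) * q\<rfloor> = int k * j" unfolding calculation by (rule floor_of_int)
    ultimately show ?thesis using j assms
      by (simp only: ramify.rep_eq fls_nth_compose_power) simp
  next
    case False
    have "fls_nth (fls_compose_power F k) \<lfloor>of_nat (m * k) * q\<rfloor> = 0" if int: "of_nat (m * k) * q \<in> \<int>"
    proof -
      obtain j where j: "of_nat (m * k) * q = of_int j" using int by (blast elim: Ints_cases)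
      have "\<not> int k dvd j"
      proof
        assume "int k dvd j"
        then obtain i where "j = int k * i" by auto
        then have "of_nat k * (of_nat m * q) = of_nat k * of_int i" using j by (simp add: mult_ac)
        then have "of_nat m * q = of_int i" using assms by simp
        with False show False by simp
      qed
      then show ?thesis using assms j by (simp add: fls_nth_compose_power)
    qed
    with False show ?thesis by (simp add: ramify.rep_eq)
  qed
qed

lemma puiseux_ramifyE2:
  obtains m F G where "m > 0" "p = ramify m F" "q = ramify m G"
proof -
  obtain a F where a: "a > 0" "p = ramify a F" by (rule puiseux_ramifyE)
  obtain b G where b: "b > 0" "q = ramify b G" by (rule puiseux_ramifyE)
  show ?thesis
  proof (rule that)
    show "a * b > 0" using a b by simp
    show "p = ramify (a * b) (fls_compose_power F b)" using a b by (simp add: ramify_refine)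
    show "q = ramify (a * b) (fls_compose_power G a)"
      using a b ramify_refine[of b a G] by (simp add: mult.commute)
  qed
qed

lemma puiseux_ramifyE3:
  obtains m F G H where "m > 0" "p = ramify m F" "q = ramify m G" "r = ramify m H"
proof -
  obtain a F G where a: "a > 0" "p = ramify a F" "q = ramify a G" by (rule puiseux_ramifyE2)
  obtain b H where b: "b > 0" "r = ramify b H" by (rule puiseux_ramifyE)
  show ?thesis
  proof (rule that)
    show "a * b > 0" using a b by simp
    show "p = ramify (a * b) (fls_compose_power F b)" using a b by (simp add: ramify_refine)
    show "q = ramify (a * b) (fls_compose_power G b)" using a b by (simp add: ramify_refine)
    show "r = ramify (a * b) (fls_compose_power H a)"
      using a b ramify_refine[of b a H] by (simp add: mult.commute)
  qed
qed

lemma ramify_inject: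
  assumes "m > 0"
  shows "ramify m F = ramify m G \<longleftrightarrow> F = G"
  by (metis assms fls_eqI ramify_nth)

lemma ramify_0 [simp]: "ramify m 0 = 0"
  by (rule puiseux_eqI) (simp add: ramify.rep_eq zero_puiseux.rep_eq)

lemma ramify_1: "m > 0 \<Longrightarrow> ramify m 1 = 1"
  by (rule puiseux_eqI)
    (auto simp: ramify.rep_eq one_puiseux.rep_eq elim!: Ints_cases)

lemma ramify_add: "ramify m (F + G) = ramify m F + ramify m G"
  by (rule puiseux_eqI) (simp add: ramify.rep_eq plus_puiseux.rep_eq)

lemma ramify_uminus: "ramify m (- F) = - ramify m F"
  by (rule puiseux_eqI) (simp add: ramify.rep_eq uminus_puiseux.rep_eq)

lemma ramify_mult:
  assumes m: "m > 0"
  shows "ramify m (F * G) = ramify m F * ramify m G"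
proof (rule puiseux_eqI)
  fix q
  define f where "f = puiseux_coeff (ramify m F)"
  define g where "g = puiseux_coeff (ramify m G)"
  define S where "S = {a. f a \<noteq> 0 \<and> g (q - a) \<noteq> 0}"
  have rhs: "puiseux_coeff (ramify m F * ramify m G) q = (\<Sum>a\<in>S. f a * g (q - a))"
    by (simp add: times_puiseux.rep_eq f_def g_def S_def)
  show "puiseux_coeff (ramify m (F * G)) q = puiseux_coeff (ramify m F * ramify m G) q"
  proof (cases "of_nat m * q \<in> \<int>")
    case True
    then obtain n where n: "of_nat m * q = of_int n" by (auto elim: Ints_cases)
    then have q: "q = of_int n / of_nat m" using m by (simp add: field_simps)
    define h where "h i = (of_int i / of_nat m :: rat)" for i :: int
    have fh: "f (h i) = fls_nth F i" for i using m by (simp add: f_def h_def ramify_nth)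
    have gh: "g (q - h i) = fls_nth G (n - i)" for i
    proof -
      have "q - h i = of_int (n - i) / of_nat m" by (simp add: q h_def diff_divide_distrib)
      then show ?thesis using m by (simp only: g_def ramify_nth)
    qed
    have inj: "inj_on h A" for A using m by (auto simp: inj_on_def h_def)
    define A where "A = {fls_subdegree F..n - fls_subdegree G}"
    have "S \<subseteq> h ` A"
    proof
      fix a assume a: "a \<in> S"
      then have "of_nat m * a \<in> \<int>" by (auto simp: S_def f_def ramify.rep_eq split: if_splits)
      then obtain i where "of_nat m * a = of_int i" by (auto elim: Ints_cases)
      then have ai: "a = h i" using m by (simp add: field_simps h_def)
      then have "fls_nth F i \<noteq> 0" "fls_nth G (n - i) \<noteq> 0" using a fh gh by (auto simp: S_def)
      then have "fls_subdegree F \<le> i" "fls_subdegree G \<le> n - i" by (auto intro: fls_subdegree_leI)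
      then show "a \<in> h ` A" using ai by (auto simp: A_def)
    qed
    then have "(\<Sum>a\<in>S. f a * g (q - a)) = (\<Sum>a\<in>h ` A. f a * g (q - a))"
      by (intro sum.mono_neutral_left) (auto simp: S_def A_def)
    also have "\<dots> = (\<Sum>i\<in>A. fls_nth F i * fls_nth G (n - i))"
      by (subst sum.reindex[OF inj]) (simp add: fh gh)
    also have "\<dots> = fls_nth (F * G) n" by (simp add: fls_times_nth(2) A_def)
    also have "\<dots> = puiseux_coeff (ramify m (F * G)) q" using m by (simp add: q ramify_nth)
    finally show ?thesis using rhs by simp
  next
    case False
    have "S = {}"
    proof (rule ccontr)
      assume "S \<noteq> {}"
      then obtain a where "f a \<noteq> 0" "g (q - a) \<noteq> 0" by (auto simp: S_def)
      then have "of_nat m * a \<in> \<int>" "of_nat m * (q - a) \<in> \<int>"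
        by (auto simp: f_def g_def ramify.rep_eq split: if_splits)
      then have "of_nat m * a + of_nat m * (q - a) \<in> \<int>" by (rule Ints_add)
      with False show False by (simp add: algebra_simps)
    qed
    with False show ?thesis using rhs by (simp add: ramify.rep_eq)
  qed
qed

instance puiseux :: comm_ring_1
proof
  fix a b c :: puiseux
  obtain m F G H where m: "m > 0" and [simp]: "a = ramify m F" "b = ramify m G" "c = ramify m H"
    by (rule puiseux_ramifyE3)
  note r = ramify_mult[OF m, symmetric] ramify_add[symmetric] ramify_uminus[symmetric]
  show "a * b * c = a * (b * c)" by (simp add: r mult.assoc)
  show "a * b = b * a" by (simp add: r mult.commute)
  show "1 * a = a" by (simp add: r ramify_1[OF m, symmetric])
  show "a + b + c = a + (b + c)" by (simp add: r add.assoc)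
  show "a + b = b + a" by (simp add: r add.commute)
  show "0 + a = a" using ramify_add[of m 0 F] by simp
  show "- a + a = 0" using ramify_add[of m "- F" F] by (simp add: ramify_uminus)
  show "a - b = a + - b" by (simp add: minus_puiseux_def)
  show "(a + b) * c = a * c + b * c" by (simp add: r algebra_simps)
  show "(0::puiseux) \<noteq> 1" by (metis m ramify_0 ramify_1 ramify_inject zero_neq_one)
qed

instantiation puiseux :: field
begin

definition inverse_puiseux :: "puiseux \<Rightarrow> puiseux" where
  "inverse_puiseux p = (if p = 0 then 0 else (THE q. p * q = 1))"

definition divide_puiseux :: "puiseux \<Rightarrow> puiseux \<Rightarrow> puiseux" where
  "divide_puiseux p q = p * inverse q"

instance
proof
  fix a b :: puiseux
  show "inverse (0::puiseux) = 0" by (simp add: inverse_puiseux_def)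
  show "a div b = a * inverse b" by (simp add: divide_puiseux_def)
  assume "a \<noteq> 0"
  obtain m F where m: "m > 0" and a: "a = ramify m F" by (rule puiseux_ramifyE)
  with \<open>a \<noteq> 0\<close> have "F \<noteq> 0" by auto
  then have 1: "a * ramify m (inverse F) = 1"
    using m by (simp add: a ramify_mult[symmetric] ramify_1)
  have "(THE q. a * q = 1) = ramify m (inverse F)"
  proof (rule the_equality)
    fix q assume "a * q = 1"
    then have "ramify m (inverse F) * (a * q) = ramify m (inverse F)" by simp
    then show "q = ramify m (inverse F)" using 1
      by (metis mult.commute mult.left_commute mult.right_neutral)
  qed (rule 1)
  then show "inverse a * a = 1" using 1 \<open>a \<noteq> 0\<close> by (simp add: inverse_puiseux_def mult.commute)
qed

end

definition puiseux_ord :: "puiseux \<Rightarrow> rat" where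
  "puiseux_ord p = (LEAST q. puiseux_coeff p q \<noteq> 0)"

definition puiseux_const :: "complex \<Rightarrow> puiseux" where
  "puiseux_const c = ramify 1 (fls_const c)"

lemma puiseux_ord_ramify:
  assumes "m > 0" "F \<noteq> 0"
  shows "puiseux_ord (ramify m F) = of_int (fls_subdegree F) / of_nat m"
  unfolding puiseux_ord_def
proof (rule Least_equality)
  show "puiseux_coeff (ramify m F) (of_int (fls_subdegree F) / of_nat m) \<noteq> 0"
    using assms by (simp only: ramify_nth nth_fls_subdegree_nonzero not_False_eq_True)
  fix q assume "puiseux_coeff (ramify m F) q \<noteq> 0"
  then have "fls_nth F \<lfloor>of_nat m * q\<rfloor> \<noteq> 0" by (auto simp: ramify.rep_eq split: if_splits)
  then have "fls_subdegree F \<le> \<lfloor>of_nat m * q\<rfloor>" by (rule fls_subdegree_leI)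
  then show "of_int (fls_subdegree F) / of_nat m \<le> q"
    using assms by (simp add: le_floor_iff field_simps)
qed


text \<open>An element of \<open>\<complex>[[x\<^sub>1,\<dots>,x\<^sub>n]]\<close> is its coefficient function; \<open>n\<close> is the number of elements of the index
  type. Polynomials are the series with finite support.\<close>

type_synonym 'n mfps = "nat ^ 'n \<Rightarrow> complex"

definition mfps_ring :: "('n::finite) mfps ring" where
  "mfps_ring = \<lparr>carrier = UNIV,
     monoid.mult = (\<lambda>f g \<alpha>. \<Sum>(\<beta>, \<gamma>) | \<beta> + \<gamma> = \<alpha>. f \<beta> * g \<gamma>),
     one = (\<lambda>\<alpha>. if \<alpha> = 0 then 1 else 0),
     zero = (\<lambda>\<alpha>. 0),
     add = (\<lambda>f g \<alpha>. f \<alpha> + g \<alpha>)\<rparr>"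

lemma finite_exponents_below: "finite {\<beta> :: nat ^ 'n::finite. \<forall>i. \<beta> $ i \<le> \<alpha> $ i}"
proof (rule finite_subset)
  show "{\<beta>. \<forall>i. \<beta> $ i \<le> \<alpha> $ i} \<subseteq> vec_lambda ` PiE UNIV (\<lambda>i. {..\<alpha> $ i})"
  proof
    fix \<beta> assume "\<beta> \<in> {\<beta>. \<forall>i. \<beta> $ i \<le> \<alpha> $ i}"
    then have "($) \<beta> \<in> PiE UNIV (\<lambda>i. {..\<alpha> $ i})" by auto
    moreover have "\<beta> = vec_lambda (($) \<beta>)" by simp
    ultimately show "\<beta> \<in> vec_lambda ` PiE UNIV (\<lambda>i. {..\<alpha> $ i})" by blast
  qed
qed (auto intro!: finite_PiE)

lemma finite_exponent_splits: "finite {(\<beta>, \<gamma>). \<beta> + \<gamma> = (\<alpha> :: nat ^ 'n::finite)}"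
proof (rule finite_subset)
  show "{(\<beta>, \<gamma>). \<beta> + \<gamma> = \<alpha>} \<subseteq>
    {\<beta>. \<forall>i. \<beta> $ i \<le> \<alpha> $ i} \<times> {\<beta>. \<forall>i. \<beta> $ i \<le> \<alpha> $ i}"
    by auto
qed (simp add: finite_exponents_below)

lemma cring_mfps_ring: "cring (mfps_ring :: ('n::finite) mfps ring)"
proof (rule cringI)
  show "abelian_group (mfps_ring :: 'n mfps ring)"
  proof (rule abelian_groupI)
    fix f assume "f \<in> carrier (mfps_ring :: 'n mfps ring)"
    show "\<exists>g\<in>carrier mfps_ring. g \<oplus>\<^bsub>mfps_ring\<^esub> f = \<zero>\<^bsub>mfps_ring\<^esub>"
      by (rule bexI[of _ "\<lambda>\<alpha>. - f \<alpha>"]) (auto simp: mfps_ring_def)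
  qed (auto simp: mfps_ring_def add.assoc add.commute)
  show "comm_monoid (mfps_ring :: 'n mfps ring)"
  proof (rule comm_monoidI)
    fix f g h :: "'n mfps"
    show "f \<otimes>\<^bsub>mfps_ring\<^esub> g \<otimes>\<^bsub>mfps_ring\<^esub> h = f \<otimes>\<^bsub>mfps_ring\<^esub> (g \<otimes>\<^bsub>mfps_ring\<^esub> h)"
    proof
      fix \<alpha> :: "nat ^ 'n"
      define S where "S = (\<lambda>\<alpha>::nat ^ 'n. {(\<beta>, \<gamma>). \<beta> + \<gamma> = \<alpha>})"
      have fin: "finite (S \<alpha>)" for \<alpha> by (simp add: S_def finite_exponent_splits)
      have "(f \<otimes>\<^bsub>mfps_ring\<^esub> g \<otimes>\<^bsub>mfps_ring\<^esub> h) \<alpha>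
          = (\<Sum>p\<in>S \<alpha>. \<Sum>q\<in>S (fst p). f (fst q) * g (snd q) * h (snd p))"
        by (simp add: mfps_ring_def S_def case_prod_unfold sum_distrib_right)
      also have "\<dots> = (\<Sum>(p, q)\<in>(SIGMA p:S \<alpha>. S (fst p)). f (fst q) * g (snd q) * h (snd p))"
        using fin by (subst sum.Sigma) auto
      also have "\<dots> = (\<Sum>(p, q)\<in>(SIGMA p:S \<alpha>. S (snd p)). f (fst p) * (g (fst q) * h (snd q)))"
        by (rule sum.reindex_bij_witness[of _
              "\<lambda>((a, s), (b, c)). ((a + b, c), (a, b))" "\<lambda>((s, c), (a, b)). ((a, b + c), (b, c))"])
          (auto simp: S_def add.assoc mult.assoc)
      also have "\<dots> = (\<Sum>p\<in>S \<alpha>. \<Sum>q\<in>S (snd p). f (fst p) * (g (fst q) * h (snd q)))"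
        using fin by (subst sum.Sigma) auto
      also have "\<dots> = (f \<otimes>\<^bsub>mfps_ring\<^esub> (g \<otimes>\<^bsub>mfps_ring\<^esub> h)) \<alpha>"
        by (simp add: mfps_ring_def S_def case_prod_unfold sum_distrib_left)
      finally show "(f \<otimes>\<^bsub>mfps_ring\<^esub> g \<otimes>\<^bsub>mfps_ring\<^esub> h) \<alpha>
        = (f \<otimes>\<^bsub>mfps_ring\<^esub> (g \<otimes>\<^bsub>mfps_ring\<^esub> h)) \<alpha>" .
    qed
    show "f \<otimes>\<^bsub>mfps_ring\<^esub> g = g \<otimes>\<^bsub>mfps_ring\<^esub> f"
    proof
      fix \<alpha>
      have "(\<Sum>(\<beta>, \<gamma>) | \<beta> + \<gamma> = \<alpha>. f \<beta> * g \<gamma>) = (\<Sum>(\<beta>, \<gamma>) | \<beta> + \<gamma> = \<alpha>. g \<beta> * f \<gamma>)"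
        by (rule sum.reindex_bij_witness[of _ prod.swap prod.swap]) (auto simp: add.commute)
      then show "(f \<otimes>\<^bsub>mfps_ring\<^esub> g) \<alpha> = (g \<otimes>\<^bsub>mfps_ring\<^esub> f) \<alpha>" by (simp add: mfps_ring_def)
    qed
    show "\<one>\<^bsub>mfps_ring\<^esub> \<otimes>\<^bsub>mfps_ring\<^esub> f = f"
    proof
      fix \<alpha> :: "nat ^ 'n"
      have "(\<Sum>(\<beta>, \<gamma>) | \<beta> + \<gamma> = \<alpha>. (if \<beta> = 0 then 1 else 0) * f \<gamma>)
          = (\<Sum>(\<beta>, \<gamma>)\<in>{(0 :: nat ^ 'n, \<alpha>)}. (if \<beta> = 0 then 1 else 0) * f \<gamma>)"
        by (rule sum.mono_neutral_right) (auto simp: finite_exponent_splits split: if_splits)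
      then show "(\<one>\<^bsub>mfps_ring\<^esub> \<otimes>\<^bsub>mfps_ring\<^esub> f) \<alpha> = f \<alpha>" by (simp add: mfps_ring_def)
    qed
  qed (auto simp: mfps_ring_def)
  fix f g h :: "'n mfps"
  show "(f \<oplus>\<^bsub>mfps_ring\<^esub> g) \<otimes>\<^bsub>mfps_ring\<^esub> h
    = f \<otimes>\<^bsub>mfps_ring\<^esub> h \<oplus>\<^bsub>mfps_ring\<^esub> g \<otimes>\<^bsub>mfps_ring\<^esub> h"
    by (simp add: mfps_ring_def case_prod_unfold algebra_simps sum.distrib)
qed

definition supp :: "'n::finite mfps \<Rightarrow> (nat ^ 'n) set" where
  "supp f = {\<alpha>. f \<alpha> \<noteq> 0}"

definition is_monomial :: "'n::finite mfps \<Rightarrow> bool" where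
  "is_monomial g \<longleftrightarrow> (\<exists>c \<alpha>. c \<noteq> 0 \<and> g = (\<lambda>\<beta>. if \<beta> = \<alpha> then c else 0))"

definition U_loc :: "(real ^ 'n::finite) set" where
  "U_loc = {u. \<forall>i. 0 \<le> u $ i}"

definition U_stratum :: "'n set \<Rightarrow> (real ^ 'n::finite) set" where
  "U_stratum J = {u. (\<forall>j\<in>J. u $ j = 0) \<and> (\<forall>i. i \<notin> J \<longrightarrow> 0 < u $ i)}"

definition pairing :: "real ^ 'n::finite \<Rightarrow> nat ^ 'n \<Rightarrow> real" where
  "pairing u \<alpha> = (\<Sum>i\<in>UNIV. u $ i * real (\<alpha> $ i))"

text \<open>The infimum lives in \<^typ>\<open>ereal\<close>, so that the zero series has weight \<open>\<infinity>\<close>. For \<open>u \<in> U_loc\<close>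
  and nonzero \<open>f\<close> it is a minimum, see \<open>wei_attained\<close> below.\<close>

definition wei :: "real ^ 'n::finite \<Rightarrow> 'n mfps \<Rightarrow> ereal" where
  "wei u f = (INF \<alpha>\<in>supp f. ereal (pairing u \<alpha>))"

definition filt :: "real ^ 'n::finite \<Rightarrow> real \<Rightarrow> 'n mfps set" where
  "filt u k = {f. ereal k \<le> wei u f}"

definition filt_gt :: "real ^ 'n::finite \<Rightarrow> real \<Rightarrow> 'n mfps set" where
  "filt_gt u k = {f. ereal k < wei u f}"

text \<open>The graded ring of the filtration is identified with a subring of the power series ring, so the
  class of \<open>f\<close> in \<open>filt u k / filt_gt u k\<close> for \<open>k = wei u f\<close> is represented by the sum of the
  terms of \<open>f\<close> of weight exactly \<open>k\<close>; see \<open>initial_form_represents_class\<close> below.\<close>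

definition initial_form :: "real ^ 'n::finite \<Rightarrow> 'n mfps \<Rightarrow> 'n mfps" where
  "initial_form u f = (\<lambda>\<alpha>. if ereal (pairing u \<alpha>) = wei u f then f \<alpha> else 0)"

definition trop :: "'n::finite mfps \<Rightarrow> real ^ 'n \<Rightarrow> ereal" where
  "trop f w = (INF \<alpha>\<in>supp f. ereal (pairing w \<alpha>))"

definition trop_hypersurface_loc :: "'n::finite mfps \<Rightarrow> (real ^ 'n) set" where
  "trop_hypersurface_loc f = {w \<in> U_loc. supp f = {} \<or>
     (\<exists>\<alpha>\<in>supp f. \<exists>\<beta>\<in>supp f. \<alpha> \<noteq> \<beta> \<and>
        ereal (pairing w \<alpha>) = trop f w \<and> ereal (pairing w \<beta>) = trop f w)}"

text \<open>The projection forgetting the coordinates in \<open>J\<close>; its target is identified with the exponents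
  vanishing on \<open>J\<close>, and \<open>up_set J B\<close> is the Minkowski sum of \<open>B\<close> with that target.\<close>

definition forget :: "'n set \<Rightarrow> nat ^ 'n \<Rightarrow> nat ^ 'n::finite" where
  "forget J \<alpha> = (\<chi> i. if i \<in> J then 0 else \<alpha> $ i)"

definition up_set :: "'n set \<Rightarrow> (nat ^ 'n::finite) set \<Rightarrow> (nat ^ 'n) set" where
  "up_set J B = {\<beta> + \<gamma> | \<beta> \<gamma>. \<beta> \<in> B \<and> (\<forall>j\<in>J. \<gamma> $ j = 0)}"

definition is_min_gens :: "'n set \<Rightarrow> 'n::finite mfps \<Rightarrow> (nat ^ 'n) set \<Rightarrow> bool" where
  "is_min_gens J f B \<longleftrightarrow> finite B \<and> B \<subseteq> forget J ` supp f \<and>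
     up_set J B = up_set J (forget J ` supp f) \<and>
     (\<forall>C. C \<subset> B \<longrightarrow> up_set J C \<noteq> up_set J (forget J ` supp f))"

text \<open>Exactly one set satisfies the description, see \<open>is_min_gens_min_gens\<close> below.\<close>

definition min_gens :: "'n set \<Rightarrow> 'n::finite mfps \<Rightarrow> (nat ^ 'n) set" where
  "min_gens J f = (THE B. is_min_gens J f B)"

lemma nat_seq_mono_subseq:
  fixes s :: "nat \<Rightarrow> nat"
  shows "\<exists>r::nat \<Rightarrow> nat. strict_mono r \<and> mono (s \<circ> r)"
proof -
  obtain r where r: "strict_mono r" "monoseq (\<lambda>n. s (r n))" using seq_monosub by blast
  consider "mono (\<lambda>n. s (r n))" | "antimono (\<lambda>n. s (r n))"
    using r(2) by (auto simp: monoseq_iff)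
  then show ?thesis
  proof cases
    case 1
    with r(1) show ?thesis by (auto simp: comp_def)
  next
    case 2
    define N where "N = (ARG_MIN (\<lambda>n. s (r n)) n. True)"
    have N: "s (r N) \<le> s (r n)" for n
      unfolding N_def by (rule arg_min_nat_le) simp
    have "s (r (n + N)) = s (r N)" for n
      using N[of "n + N"] antimonoD[OF 2, of N "n + N"] by simp
    then have "mono (s \<circ> (\<lambda>n. r (n + N)))" by (simp add: mono_def)
    moreover have "strict_mono (\<lambda>n. r (n + N))" using r(1) by (simp add: strict_mono_def)
    ultimately show ?thesis by blast
  qed
qed

lemma exponent_seq_good:
  fixes s :: "nat \<Rightarrow> nat ^ 'n::finite"
  shows "\<exists>m n. m < n \<and> (\<forall>i. s m $ i \<le> s n $ i)"
proof -
  have "\<exists>r::nat \<Rightarrow> nat. strict_mono r \<and> (\<forall>i\<in>S. mono (\<lambda>k. s (r k) $ i))"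
    if "finite S" for S
    using that
  proof induction
    case empty
    show ?case by (rule exI[of _ "\<lambda>k. k"]) (simp add: strict_mono_def)
  next
    case (insert i S)
    then obtain r :: "nat \<Rightarrow> nat" where r: "strict_mono r" "\<forall>i\<in>S. mono (\<lambda>k. s (r k) $ i)" by blast
    obtain t where t: "strict_mono (t :: nat \<Rightarrow> nat)" "mono ((\<lambda>k. s (r k) $ i) \<circ> t)"
      using nat_seq_mono_subseq by blast
    have "mono (\<lambda>k. s (r (t k)) $ j)" if "j \<in> S" for j
      using r(2) that t(1) by (auto simp: mono_def strict_mono_less_eq)
    moreover have "strict_mono (r \<circ> t)" using r(1) t(1) by (rule strict_mono_o)
    ultimately show ?case using t(2) by (auto simp: comp_def intro!: exI[of _ "r \<circ> t"])
  qed
  then obtain r :: "nat \<Rightarrow> nat" where "strict_mono r" "\<forall>i. mono (\<lambda>k. s (r k) $ i)"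
    by (metis UNIV_I finite)
  then show ?thesis
    by (intro exI[of _ "r 0"] exI[of _ "r 1"]) (auto simp: strict_mono_def mono_def)
qed

definition minimals :: "(nat ^ 'n::finite) set \<Rightarrow> (nat ^ 'n) set" where
  "minimals P = {m \<in> P. \<forall>p\<in>P. (\<forall>i. p $ i \<le> m $ i) \<longrightarrow> p = m}"

lemma minimalsD: "m \<in> minimals P \<Longrightarrow> p \<in> P \<Longrightarrow> (\<And>i. p $ i \<le> m $ i) \<Longrightarrow> p = m"
  by (simp add: minimals_def)

lemma finite_minimals: "finite (minimals P)"
proof (rule ccontr)
  assume "infinite (minimals P)"
  then obtain s :: "nat \<Rightarrow> _" where s: "inj s" "range s \<subseteq> minimals P"
    using infinite_countable_subset by blast
  obtain m n where mn: "m < n" "\<forall>i. s m $ i \<le> s n $ i" using exponent_seq_good by blast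
  have "s m \<in> P" "s n \<in> minimals P" using s(2) by (auto simp: minimals_def)
  then have "s m = s n" using mn(2) by (auto simp: minimals_def)
  with s(1) mn(1) show False by (auto dest: injD)
qed

lemma minimals_below:
  assumes "p \<in> P"
  shows "\<exists>m\<in>minimals P. \<forall>i. m $ i \<le> p $ i"
  using assms
proof (induction "\<Sum>i\<in>UNIV. p $ i" arbitrary: p rule: less_induct)
  case less
  show ?case
  proof (cases "p \<in> minimals P")
    case True
    then show ?thesis by blast
  next
    case False
    then obtain q where q: "q \<in> P" "\<forall>i. q $ i \<le> p $ i" "q \<noteq> p"
      using less.prems by (auto simp: minimals_def)
    obtain i where "q $ i \<noteq> p $ i" using q(3) by (auto simp: vec_eq_iff)
    then have "q $ i < p $ i" using q(2) by (simp add: order.not_eq_order_implies_strict)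
    then have "(\<Sum>i\<in>UNIV. q $ i) < (\<Sum>i\<in>UNIV. p $ i)"
      using q(2) by (intro sum_strict_mono_ex1) auto
    then obtain m where "m \<in> minimals P" "\<forall>i. m $ i \<le> q $ i"
      using less.hyps q(1) by blast
    then show ?thesis using q(2) by (meson order_trans)
  qed
qed

lemma is_min_gens_iff: "is_min_gens J f B \<longleftrightarrow> B = minimals (forget J ` supp f)"
proof -
  define P where "P = forget J ` supp f"
  have P0: "p $ j = 0" if "p \<in> P" "j \<in> J" for p j
    using that by (auto simp: P_def forget_def)
  have sub: "minimals P \<subseteq> C" if C: "C \<subseteq> P" "up_set J C = up_set J P" for C
  proof
    fix m assume m: "m \<in> minimals P"
    then have "m + 0 \<in> up_set J P"
      unfolding up_set_def minimals_def by (intro CollectI exI[of _ m] exI[of _ 0]) simp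
    then obtain b c where bc: "b \<in> C" "m = b + c"
      unfolding C(2)[symmetric] by (auto simp: up_set_def)
    have "b = m"
    proof (rule minimalsD[OF m])
      show "b \<in> P" using bc(1) C(1) by (rule subsetD[rotated])
      show "b $ i \<le> m $ i" for i unfolding bc(2) by simp
    qed
    then show "m \<in> C" using bc(1) by (rule subst)
  qed
  have gen: "up_set J (minimals P) = up_set J P"
  proof
    show "up_set J (minimals P) \<subseteq> up_set J P" by (auto simp: up_set_def minimals_def)
    show "up_set J P \<subseteq> up_set J (minimals P)"
    proof
      fix x assume "x \<in> up_set J P"
      then obtain p c where pc: "p \<in> P" "\<forall>j\<in>J. c $ j = 0" "x = p + c" by (auto simp: up_set_def)
      obtain m where m: "m \<in> minimals P" "\<forall>i. m $ i \<le> p $ i" using minimals_below pc(1) by blast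
      have "x $ i = (m + (p - m + c)) $ i" for i using spec[OF m(2), of i] pc(3) by simp
      then have "x = m + (p - m + c)" by (simp add: vec_eq_iff)
      moreover have "\<forall>j\<in>J. (p - m + c) $ j = 0" using P0[OF pc(1)] pc(2) by simp
      ultimately show "x \<in> up_set J (minimals P)" using m(1) unfolding up_set_def by blast
    qed
  qed
  have "minimals P \<subseteq> P" by (auto simp: minimals_def)
  show ?thesis
    unfolding is_min_gens_def P_def[symmetric]
  proof
    assume B: "finite B \<and> B \<subseteq> P \<and> up_set J B = up_set J P \<and>
      (\<forall>C. C \<subset> B \<longrightarrow> up_set J C \<noteq> up_set J P)"
    then have "minimals P \<subseteq> B" using sub by blast
    with B gen show "B = minimals P" by blast
  next
    assume B: "B = minimals P"
    have "up_set J C \<noteq> up_set J P" if "C \<subset> minimals P" for C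
      using sub[of C] that \<open>minimals P \<subseteq> P\<close> by blast
    then show "finite B \<and> B \<subseteq> P \<and> up_set J B = up_set J P \<and>
      (\<forall>C. C \<subset> B \<longrightarrow> up_set J C \<noteq> up_set J P)"
      using gen \<open>minimals P \<subseteq> P\<close> by (simp add: B finite_minimals)
  qed
qed

lemma min_gens_eq_minimals: "min_gens J f = minimals (forget J ` supp f)"
  by (simp add: min_gens_def is_min_gens_iff)

lemma is_min_gens_min_gens: "is_min_gens J f (min_gens J f)"
  by (simp add: is_min_gens_iff min_gens_eq_minimals)

lemma wei_attained:
  assumes "u \<in> U_loc" "supp f \<noteq> {}"
  obtains \<alpha> where "\<alpha> \<in> supp f" "wei u f = ereal (pairing u \<alpha>)"
proof -
  have mono: "pairing u \<alpha> \<le> pairing u \<beta>" if "\<forall>i. \<alpha> $ i \<le> \<beta> $ i" for \<alpha> \<beta>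
    unfolding pairing_def using assms(1) that
    by (intro sum_mono mult_left_mono) (auto simp: U_loc_def)
  have ne: "minimals (supp f) \<noteq> {}" using assms(2) minimals_below by blast
  obtain \<alpha> where \<alpha>: "\<alpha> \<in> minimals (supp f)"
    "\<And>\<beta>. \<beta> \<in> minimals (supp f) \<Longrightarrow> pairing u \<alpha> \<le> pairing u \<beta>"
    using arg_min_if_finite(1)[OF finite_minimals ne, of "pairing u"]
      arg_min_least[OF finite_minimals ne, of _ "pairing u"] by blast
  have "wei u f = ereal (pairing u \<alpha>)"
    unfolding wei_def
  proof (rule antisym)
    show "(INF \<alpha>\<in>supp f. ereal (pairing u \<alpha>)) \<le> ereal (pairing u \<alpha>)"
      using \<alpha>(1) by (auto simp: minimals_def intro: INF_lower)
    show "ereal (pairing u \<alpha>) \<le> (INF \<alpha>\<in>supp f. ereal (pairing u \<alpha>))"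
    proof (rule INF_greatest)
      fix \<beta> assume "\<beta> \<in> supp f"
      then obtain \<gamma> where "\<gamma> \<in> minimals (supp f)" "\<forall>i. \<gamma> $ i \<le> \<beta> $ i"
        using minimals_below by blast
      then show "ereal (pairing u \<alpha>) \<le> ereal (pairing u \<beta>)"
        using \<alpha>(2) mono by (meson ereal_less_eq(3) order_trans)
    qed
  qed
  moreover have "\<alpha> \<in> supp f" using \<alpha>(1) by (simp add: minimals_def)
  ultimately show ?thesis by (rule that[rotated])
qed

lemma initial_form_represents_class:
  assumes "u \<in> U_loc" "supp f \<noteq> {}"
  obtains k where "wei u f = ereal k" "f \<in> filt u k" "initial_form u f \<in> filt u k"
    "f \<ominus>\<^bsub>mfps_ring\<^esub> initial_form u f \<in> filt_gt u k"
    "\<forall>\<alpha>\<in>supp (initial_form u f). pairing u \<alpha> = k"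
proof -
  obtain \<alpha> where \<alpha>: "\<alpha> \<in> supp f" "wei u f = ereal (pairing u \<alpha>)"
    using assms by (rule wei_attained)
  define k where "k = pairing u \<alpha>"
  have k: "wei u f = ereal k" using \<alpha> by (simp add: k_def)
  define g where "g = (\<lambda>\<alpha>. f \<alpha> - initial_form u f \<alpha>)"
  interpret cring mfps_ring by (rule cring_mfps_ring)
  have "g \<oplus>\<^bsub>mfps_ring\<^esub> initial_form u f = f" by (simp add: mfps_ring_def g_def)
  moreover have "carrier mfps_ring = UNIV" by (simp add: mfps_ring_def)
  ultimately have g: "f \<ominus>\<^bsub>mfps_ring\<^esub> initial_form u f = g"
    by (metis UNIV_I a_minus_def add.inv_closed add.m_assoc r_neg r_zero)
  have deg: "\<forall>\<alpha>\<in>supp (initial_form u f). pairing u \<alpha> = k"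
    by (auto simp: supp_def initial_form_def k split: if_splits)
  have 1: "f \<in> filt u k" by (simp add: filt_def k)
  have 2: "initial_form u f \<in> filt u k"
    unfolding filt_def wei_def using deg by (auto intro: INF_greatest)
  have 3: "g \<in> filt_gt u k"
  proof (cases "supp g = {}")
    case True
    then show ?thesis by (simp add: filt_gt_def wei_def top_ereal_def)
  next
    case False
    obtain \<beta> where \<beta>: "\<beta> \<in> supp g" "wei u g = ereal (pairing u \<beta>)"
      using assms(1) False by (rule wei_attained)
    then have "\<beta> \<in> supp f" "ereal (pairing u \<beta>) \<noteq> wei u f"
      by (auto simp: supp_def g_def initial_form_def split: if_splits)
    moreover have "wei u f \<le> ereal (pairing u \<beta>)"
      unfolding wei_def using \<open>\<beta> \<in> supp f\<close> by (rule INF_lower)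
    ultimately show ?thesis using \<beta>(2) k by (simp add: filt_gt_def)
  qed
  show ?thesis using that[OF k 1 2 _ deg] 3 g by simp
qed

definition fiber :: "'n set \<Rightarrow> 'n::finite mfps \<Rightarrow> nat ^ 'n \<Rightarrow> (nat ^ 'n) set" where
  "fiber J f \<beta> = {\<alpha> \<in> supp f. forget J \<alpha> = \<beta>}"

definition restrict_terms :: "(nat ^ 'n) set \<Rightarrow> 'n::finite mfps \<Rightarrow> 'n mfps" where
  "restrict_terms S f = (\<lambda>\<alpha>. if \<alpha> \<in> S then f \<alpha> else 0)"

definition f_tilde :: "'n set \<Rightarrow> 'n::finite mfps \<Rightarrow> 'n mfps" where
  "f_tilde J f = (if J = UNIV then (\<lambda>\<alpha>. 0)
     else restrict_terms (\<Union>\<beta>\<in>min_gens J f. fiber J f \<beta>) f)"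

text \<open>A simultaneous choice, for every stratum \<open>J\<close>, series \<open>f\<close> and minimal generator \<open>\<beta>\<close>, of the
  set of at most two terms kept in \<open>f_hat\<close>. A fiber that is not a singleton has at least two,
  possibly infinitely many, elements.\<close>

type_synonym 'n term_choice = "'n set \<Rightarrow> 'n mfps \<Rightarrow> nat ^ 'n \<Rightarrow> (nat ^ 'n) set"

definition is_term_choice :: "'n::finite term_choice \<Rightarrow> bool" where
  "is_term_choice A \<longleftrightarrow> (\<forall>J f. J \<noteq> UNIV \<longrightarrow> (\<forall>\<beta>\<in>min_gens J f.
     if is_singleton (fiber J f \<beta>) then A J f \<beta> = fiber J f \<beta>
     else A J f \<beta> \<subseteq> fiber J f \<beta> \<and> card (A J f \<beta>) = 2))"

definition f_hat :: "'n::finite term_choice \<Rightarrow> 'n set \<Rightarrow> 'n mfps \<Rightarrow> 'n mfps" where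
  "f_hat A J f = (if J = UNIV then (\<lambda>\<alpha>. 0)
     else restrict_terms (\<Union>\<beta>\<in>min_gens J f. A J f \<beta>) f)"

lemma term_choice_exists: "\<exists>A :: 'n::finite term_choice. is_term_choice A"
proof -
  define Q where "Q = (\<lambda>J (f :: 'n mfps) \<beta> S. if is_singleton (fiber J f \<beta>) then S = fiber J f \<beta>
    else S \<subseteq> fiber J f \<beta> \<and> card S = 2)"
  have Q: "Q J f \<beta> (SOME S. Q J f \<beta> S)" if "\<beta> \<in> min_gens J f" for J f \<beta>
  proof (rule someI_ex, cases "is_singleton (fiber J f \<beta>)")
    case False
    have "fiber J f \<beta> \<noteq> {}"
      using that by (auto simp: min_gens_eq_minimals minimals_def fiber_def)
    then obtain a b where "a \<in> fiber J f \<beta>" "b \<in> fiber J f \<beta>" "a \<noteq> b"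
      using False by (metis is_singletonI')
    then show "\<exists>S. Q J f \<beta> S" using False by (intro exI[of _ "{a, b}"]) (simp add: Q_def)
  qed (simp add: Q_def)
  have "is_term_choice A \<longleftrightarrow> (\<forall>J f. J \<noteq> UNIV \<longrightarrow> (\<forall>\<beta>\<in>min_gens J f. Q J f \<beta> (A J f \<beta>)))" for A
    by (simp add: is_term_choice_def Q_def)
  then have "is_term_choice (\<lambda>J f \<beta>. SOME S. Q J f \<beta> S)" using Q by simp
  then show ?thesis by blast
qed

lemma finite_supp_f_hat:
  assumes "is_term_choice A"
  shows "finite (supp (f_hat A J f))"
proof (cases "J = UNIV")
  case True
  then show ?thesis by (simp add: f_hat_def supp_def)
next
  case False
  have "finite (A J f \<beta>)" if "\<beta> \<in> min_gens J f" for \<beta>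
  proof (cases "is_singleton (fiber J f \<beta>)")
    case True
    then have "A J f \<beta> = fiber J f \<beta>" using assms False that by (auto simp: is_term_choice_def)
    then show ?thesis using True by (auto simp: is_singleton_def)
  next
    case non: False
    then have "card (A J f \<beta>) = 2" using assms False that by (auto simp: is_term_choice_def)
    then show ?thesis by (metis card.infinite zero_neq_numeral)
  qed
  then have "finite (\<Union>\<beta>\<in>min_gens J f. A J f \<beta>)"
    by (simp add: min_gens_eq_minimals finite_minimals)
  moreover have "supp (f_hat A J f) \<subseteq> (\<Union>\<beta>\<in>min_gens J f. A J f \<beta>)"
    using False by (auto simp: f_hat_def supp_def restrict_terms_def split: if_splits)
  ultimately show ?thesis by (rule finite_subset[rotated])
qed


text \<open>Meant for series of finite support; \<open>f_hat\<close> has finite support by \<open>finite_supp_f_hat\<close>.\<close>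

definition poly_eval :: "'n::finite mfps \<Rightarrow> puiseux ^ 'n \<Rightarrow> puiseux" where
  "poly_eval g v = (\<Sum>\<alpha>\<in>supp g. puiseux_const (g \<alpha>) * (\<Prod>i\<in>UNIV. (v $ i) ^ (\<alpha> $ i)))"

definition torus_variety :: "'n::finite mfps \<Rightarrow> (puiseux ^ 'n) set" where
  "torus_variety g = {v. (\<forall>i. v $ i \<noteq> 0) \<and> poly_eval g v = 0}"

definition ord_vec :: "puiseux ^ 'n \<Rightarrow> real ^ 'n::finite" where
  "ord_vec v = (\<chi> i. real_of_rat (puiseux_ord (v $ i)))"

definition trop_by_initial_forms :: "'n::finite mfps set \<Rightarrow> (real ^ 'n) set" where
  "trop_by_initial_forms I = {w \<in> U_loc. \<forall>f\<in>I. \<not> is_monomial (initial_form w f)}"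

definition trop_by_series :: "'n::finite mfps set \<Rightarrow> (real ^ 'n) set" where
  "trop_by_series I = (\<Inter>f\<in>I. trop_hypersurface_loc f)"

definition trop_by_tilde :: "'n::finite mfps set \<Rightarrow> (real ^ 'n) set" where
  "trop_by_tilde I =
     (\<Union>J. (\<Inter>f\<in>I. trop_hypersurface_loc (f_tilde J f)) \<inter> U_stratum J)"

definition trop_by_hat :: "'n::finite term_choice \<Rightarrow> 'n mfps set \<Rightarrow> (real ^ 'n) set" where
  "trop_by_hat A I =
     (\<Union>J. (\<Inter>f\<in>I. trop_hypersurface_loc (f_hat A J f)) \<inter> U_stratum J)"

definition trop_by_ord :: "'n::finite term_choice \<Rightarrow> 'n mfps set \<Rightarrow> (real ^ 'n) set" where
  "trop_by_ord A I =
     (\<Union>J. (\<Inter>f\<in>I. closure (ord_vec ` torus_variety (f_hat A J f))) \<inter> U_stratum J)"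

text \<open>The origin always lies in the stratified set, since \<open>f_tilde UNIV f = 0\<close>, whereas an ideal
  containing a monomial has no point at all in \<open>trop_by_initial_forms\<close>. So for such ideals
  (for instance the unit ideal) the two sets differ, by exactly the origin.\<close>

lemma origin_in_trop_by_tilde: "0 \<in> trop_by_tilde I"
proof -
  have "0 \<in> (\<Inter>f\<in>I. trop_hypersurface_loc (f_tilde UNIV f)) \<inter> U_stratum UNIV"
    by (auto simp: f_tilde_def trop_hypersurface_loc_def supp_def U_loc_def U_stratum_def)
  then show ?thesis unfolding trop_by_tilde_def by blast
qed

lemma trop_by_initial_forms_empty:
  assumes "m \<in> I" "is_monomial m"
  shows "trop_by_initial_forms I = {}"
proof -
  obtain c \<alpha> where c: "c \<noteq> 0" "m = (\<lambda>\<beta>. if \<beta> = \<alpha> then c else 0)"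
    using assms(2) by (auto simp: is_monomial_def)
  then have "supp m = {\<alpha>}" by (auto simp: supp_def)
  then have "initial_form w m = m" for w
    by (auto simp: initial_form_def wei_def c(2))
  then have "is_monomial (initial_form w m)" for w using assms(2) by simp
  then show ?thesis using assms(1) by (auto simp: trop_by_initial_forms_def)
qed

end

theory Submission
  imports Defs "HOL-Computational_Algebra.Fundamental_Theorem_Algebra"
begin

text \<open>
All five sets are compared one series \<open>f\<close> at a time, and one point \<open>w\<close> at a time.

Everything depends on the set of exponents of \<open>f\<close> of least \<open>w\<close>-weight, called \<open>minimizers\<close> below.
It is the support of the initial form, so the initial form is a monomial exactly when the minimum is
attained once (\<open>initial_form_monomial_iff\<close>). On the stratum of \<open>J\<close> the weight of an exponent depends
only on its projection forgetting \<open>J\<close>, and increases strictly with it. Minimizers of \<open>f\<close> therefore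
lie over minimal generators, and passing to \<open>f_tilde\<close> loses none of them (\<open>trop_f_tilde_iff\<close>); whether
the minimum is attained twice is still visible when at most two exponents are kept over each generator
(\<open>trop_f_hat_iff\<close>). The stratum of the full index set consists of the origin, where \<open>f_tilde\<close>
is zero by definition. There the comparison is only possible if no \<open>f\<close> in the ideal is a
monomial, which means that the support of each nonzero \<open>f\<close> has at least two elements
(\<open>origin_in_trop_by_series\<close>).

What remains is Kapranov's theorem for a polynomial \<open>g\<close> with complex coefficients
(\<open>closure_ord_torus_variety\<close>): the closure of the orders of its zeros over the Puiseux series is the
set of \<open>w\<close> where the minimum is attained twice. Two ingredients carry it. First, the polyhedra forming
this set are rational, and Dirichlet's approximation theorem provides rational points in them near
any \<open>w\<close> (\<open>rational_point_preserving_signs\<close>). Second, over a rational point all but one coordinate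
can be chosen as generic monomials in \<open>t\<close>, which reduces the search for a zero to a polynomial in one
variable over the Puiseux series; its reduction has a nonzero complex root, and every root of the
reduction lifts (\<open>puiseux_root_lifts\<close>). The initial form of \<open>g\<close> can be a proper power, so roots of
any multiplicity must be lifted. This is done by induction on the multiplicity, with Hensel's
lemma for simple roots used on a higher derivative.
\<close>

section \<open>Lifting simple roots to power series\<close>

locale ring_map =
  fixes h :: "'a::idom \<Rightarrow> 'b::idom"
  assumes one: "h 1 = 1" and add: "h (a + b) = h a + h b" and mult: "h (a * b) = h a * h b"
begin

lemma zero: "h 0 = 0"
proof -
  have "h 0 + 0 = h 0 + h 0" using add[of 0 0] by simp
  then show ?thesis by (simp only: add_left_cancel)
qed

lemma of_nat: "h (of_nat n) = of_nat n"
  by (induction n) (simp_all add: zero one add)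

lemma map_poly_add: "map_poly h (p + q) = map_poly h p + map_poly h q"
  by (rule poly_eqI) (simp add: coeff_map_poly zero add)

lemma poly_eval: "h (poly p x) = poly (map_poly h p) (h x)"
  by (induction p) (simp_all add: zero add mult map_poly_pCons)

lemma map_poly_translate: "map_poly h (pcompose p [:x, 1:]) = pcompose (map_poly h p) [:h x, 1:]"
proof (induction p)
  case (pCons a p)
  have lin: "map_poly h ([:x, 1:] * q) = [:h x, 1:] * map_poly h q" for q
    by (simp add: map_poly_add map_poly_pCons zero one map_poly_smult mult)
  show ?case
    by (simp only: pcompose_pCons map_poly_add lin pCons.IH map_poly_pCons[where f = h, OF zero] map_poly_0)
qed simp

lemma map_poly_pderiv: "map_poly h (pderiv p) = pderiv (map_poly h p)"
  by (rule poly_eqI) (simp add: coeff_map_poly coeff_pderiv zero one add mult of_nat)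

lemma map_poly_higher_pderiv: "map_poly h ((pderiv ^^ k) p) = (pderiv ^^ k) (map_poly h p)"
  by (induction k) (simp_all add: map_poly_pderiv)

end

lemma poly_first_order_expansion:
  fixes p :: "'a::idom poly"
  shows "\<exists>c. poly p (x + y) = poly p x + y * poly (pderiv p) x + y ^ 2 * c"
proof (induction p)
  case 0
  show ?case by (intro exI[of _ 0]) simp
next
  case (pCons a p)
  then obtain c where c: "poly p (x + y) = poly p x + y * poly (pderiv p) x + y ^ 2 * c" by blast
  show ?case
    by (rule exI[of _ "poly (pderiv p) x + (x + y) * c"])
      (simp add: c pderiv_pCons algebra_simps power2_eq_square)
qed

lemma translate_higher_pderiv:
  fixes p :: "'a::idom poly"
  shows "(pderiv ^^ k) (pcompose p [:x, 1:]) = pcompose ((pderiv ^^ k) p) [:x, 1:]"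
  by (induction k) (simp_all add: pderiv_pcompose pderiv_pCons)

lemma poly_higher_pderiv:
  fixes p :: "'a::{idom,semiring_char_0} poly"
  shows "poly ((pderiv ^^ k) p) x = fact k * coeff (pcompose p [:x, 1:]) k"
proof -
  have "poly ((pderiv ^^ k) p) x = coeff ((pderiv ^^ k) (pcompose p [:x, 1:])) 0"
    by (simp add: translate_higher_pderiv)
  also have "\<dots> = fact k * coeff (pcompose p [:x, 1:]) k"
    by (simp add: coeff_higher_pderiv pochhammer_fact)
  finally show ?thesis .
qed

text \<open>Translating a root to the origin turns its multiplicity into the index of the first nonzero
coefficient, which is how multiplicities are read off below.\<close>

lemma translate_order_coeffs:
  fixes p :: "'a::field poly"
  assumes "p \<noteq> 0"
  shows "i < Polynomial.order c p \<Longrightarrow> coeff (pcompose p [:c, 1:]) i = 0"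
    and "coeff (pcompose p [:c, 1:]) (Polynomial.order c p) \<noteq> 0"
proof -
  obtain q where q: "p = [:-c, 1:] ^ Polynomial.order c p * q" "\<not> [:-c, 1:] dvd q"
    using order_decomp[OF assms] by blast
  have "pcompose ([:-c, 1:] ^ k) [:c, 1:] = monom 1 k" for k
  proof (induction k)
    case (Suc k)
    have "pcompose [:-c, 1:] [:c, 1:] = [:0, 1:]" by (simp add: pcompose_pCons)
    then show ?case by (simp only: power_Suc pcompose_mult Suc) (simp add: monom_Suc)
  qed (simp add: pcompose_1)
  then have eq: "pcompose p [:c, 1:] = monom 1 (Polynomial.order c p) * pcompose q [:c, 1:]"
    by (subst q(1)) (simp add: pcompose_mult)
  show "i < Polynomial.order c p \<Longrightarrow> coeff (pcompose p [:c, 1:]) i = 0"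
    by (simp add: eq coeff_monom_mult)
  show "coeff (pcompose p [:c, 1:]) (Polynomial.order c p) \<noteq> 0"
    using q(2) by (simp add: eq coeff_monom_mult poly_eq_0_iff_dvd)
qed

interpretation fps_residue: ring_map "\<lambda>f::complex fps. fps_nth f 0"
  by standard auto

lemma fps_X_power_dvd_iff: "fps_X ^ n dvd f \<longleftrightarrow> (\<forall>k<n. fps_nth f k = 0)"
  for f :: "'a::comm_ring_1 fps"
proof
  assume "\<forall>k<n. fps_nth f k = 0"
  then have "f = fps_X ^ n * fps_shift n f"
    by (intro fps_ext) (simp add: fps_X_power_mult_nth)
  then show "fps_X ^ n dvd f" by (rule dvdI)
qed (auto simp: fps_X_power_mult_nth)

text \<open>Hensel's lemma for a simple root of the reduction modulo \<open>t\<close>. Adding \<open>a t\<^sup>n\<close> to an approximate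
root changes the value in degree \<open>n\<close> by \<open>a\<close> times the derivative of the reduction at \<open>c\<close>; as this
derivative is nonzero, one coefficient of the root can be solved for at a time.\<close>

lemma fps_simple_root_lifts:
  fixes P :: "complex fps poly"
  defines "Pb \<equiv> map_poly (\<lambda>f. fps_nth f 0) P"
  assumes root: "poly Pb c = 0" and simple: "poly (pderiv Pb) c \<noteq> 0"
  obtains x where "fps_nth x 0 = c" "poly P x = 0"
proof -
  define d where "d = poly (pderiv Pb) c"
  \<comment> \<open>\<open>s n\<close> is a root modulo \<open>t\<^bsup>n+1\<^esup>\<close>; the correction cancels the error in degree \<open>n + 1\<close>.\<close>
  define s where "s = rec_nat (fps_const c)
    (\<lambda>n y. y - fps_const (fps_nth (poly P y) (Suc n) / d) * fps_X ^ Suc n)"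
  have s0: "s 0 = fps_const c" by (simp add: s_def)
  have sSuc: "s (Suc n) = s n + - (fps_const (fps_nth (poly P (s n)) (Suc n) / d) * fps_X ^ Suc n)" for n
    by (simp add: s_def)
  have res: "fps_nth (s n) 0 = c" for n
    by (induction n) (simp_all add: s0 sSuc)
  have approx: "fps_X ^ Suc n dvd poly P (s n)" for n
  proof (induction n)
    case 0
    have "fps_nth (poly P (s 0)) 0 = 0"
      using root by (simp add: fps_residue.poly_eval res Pb_def)
    then show ?case by (simp only: fps_X_power_dvd_iff) simp
  next
    case (Suc n)
    define a where "a = - fps_nth (poly P (s n)) (Suc n) / d"
    define y where "y = fps_const a * fps_X ^ Suc n"
    have sy: "s (Suc n) = s n + y" by (simp add: sSuc y_def a_def fps_const_neg[symmetric] del: fps_const_neg)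
    obtain r where r: "poly P (s n + y) = poly P (s n) + y * poly (pderiv P) (s n) + y ^ 2 * r"
      using poly_first_order_expansion by blast
    have y2: "y ^ 2 * r = fps_X ^ (Suc (Suc n)) * (fps_X ^ n * fps_const (a ^ 2) * r)"
      by (simp add: y_def power_mult_distrib power2_eq_square algebra_simps)
    have d: "fps_nth (poly (pderiv P) (s n)) 0 = d"
      by (simp add: fps_residue.poly_eval res fps_residue.map_poly_pderiv d_def Pb_def)
    have "fps_nth (poly P (s (Suc n))) k = 0" if "k < Suc (Suc n)" for k
    proof -
      have 1: "fps_nth (y ^ 2 * r) k = 0" using that unfolding y2 by (simp only: fps_X_power_mult_nth) simp
      have y1: "y * poly (pderiv P) (s n) = fps_X ^ Suc n * (fps_const a * poly (pderiv P) (s n))"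
        by (simp add: y_def algebra_simps)
      show ?thesis
      proof (cases "k = Suc n")
        case True
        have "fps_nth (y * poly (pderiv P) (s n)) k = a * d"
          unfolding y1 True by (simp only: fps_X_power_mult_nth) (simp add: d)
        then show ?thesis using 1 True simple by (simp add: sy r a_def d_def)
      next
        case False
        then have "k < Suc n" using that by simp
        moreover from this have "fps_nth (y * poly (pderiv P) (s n)) k = 0"
          unfolding y1 by (simp only: fps_X_power_mult_nth) simp
        moreover have "fps_nth (poly P (s n)) k = 0" using Suc \<open>k < Suc n\<close> fps_X_power_dvd_iff by blast
        ultimately show ?thesis using 1 by (simp add: sy r)
      qed
    qed
    then show ?case using fps_X_power_dvd_iff by blast
  qed
  define x where "x = Abs_fps (\<lambda>k. fps_nth (s k) k)"
  have stable: "fps_nth (s (n + j)) k = fps_nth (s n) k" if "k \<le> n" for n j k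
  proof (induction j)
    case (Suc j)
    have "fps_nth (fps_const a * fps_X ^ Suc (n + j)) k = (0::complex)" for a
      using that by (simp only: fps_mult_left_const_nth fps_X_power_nth) simp
    then show ?case using Suc by (simp only: sSuc add_Suc_right fps_add_nth fps_neg_nth) simp
  qed simp
  have "poly P x = 0"
  proof (rule fps_ext)
    fix n
    have "fps_nth (x - s n) k = 0" if "k < Suc n" for k
      using stable[of k k "n - k"] that by (simp add: x_def)
    then have "fps_X ^ Suc n dvd x - s n" using fps_X_power_dvd_iff by blast
    also obtain r where "poly P (s n + (x - s n)) =
      poly P (s n) + (x - s n) * poly (pderiv P) (s n) + (x - s n) ^ 2 * r"
      using poly_first_order_expansion by blast
    then have "poly P x - poly P (s n) = (x - s n) * (poly (pderiv P) (s n) + (x - s n) * r)"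
      by (simp add: algebra_simps power2_eq_square)
    then have "x - s n dvd poly P x - poly P (s n)" by simp
    finally have "fps_X ^ Suc n dvd poly P x" using approx[of n] by (simp add: dvd_diff_left_iff)
    then show "fps_nth (poly P x) n = fps_nth 0 n" using fps_X_power_dvd_iff by (metis lessI fps_zero_nth)
  qed
  moreover have "fps_nth x 0 = c" by (simp add: x_def res)
  ultimately show ?thesis using that by blast
qed

text \<open>A root of multiplicity \<open>k + 1\<close> of the reduction is a simple root of its \<open>k\<close>-th derivative, and
there it lifts. Up to a factorial, the value of the \<open>k\<close>-th derivative is the coefficient of index
\<open>k\<close> of the translated polynomial, so this plays the part of the Tschirnhaus substitution for
polynomials whose degree may exceed \<open>k + 1\<close>.\<close>

lemma fps_translate_kills_subleading:
  fixes P :: "complex fps poly"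
  defines "Pb \<equiv> map_poly (\<lambda>f. fps_nth f 0) P"
  assumes "Pb \<noteq> 0" and r: "Polynomial.order c Pb = Suc k"
  obtains x where "fps_nth x 0 = c" "coeff (pcompose P [:x, 1:]) k = 0"
proof -
  have res: "map_poly (\<lambda>f. fps_nth f 0) ((pderiv ^^ j) P) = (pderiv ^^ j) Pb" for j
    by (simp add: Pb_def fps_residue.map_poly_higher_pderiv)
  have 1: "poly (map_poly (\<lambda>f. fps_nth f 0) ((pderiv ^^ k) P)) c = 0"
    using translate_order_coeffs(1)[OF assms(2), of k c] r by (simp add: res poly_higher_pderiv)
  have "poly ((pderiv ^^ Suc k) Pb) c \<noteq> 0"
    using translate_order_coeffs(2)[OF assms(2), of c] unfolding poly_higher_pderiv r
    by (simp del: fact_Suc)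
  then have 2: "poly (pderiv (map_poly (\<lambda>f. fps_nth f 0) ((pderiv ^^ k) P))) c \<noteq> 0"
    by (simp add: res)
  obtain x where x: "fps_nth x 0 = c" "poly ((pderiv ^^ k) P) x = 0"
    using fps_simple_root_lifts[OF 1 2] by blast
  have "(fact k :: complex fps) * coeff (pcompose P [:x, 1:]) k = 0"
    using x(2) by (simp add: poly_higher_pderiv)
  then have "coeff (pcompose P [:x, 1:]) k = 0" by simp
  with x(1) show ?thesis by (rule that)
qed

text \<open>The only polynomials of degree \<open>k + 1\<close> with a root of full multiplicity are the multiples of
\<open>(z - d)\<^bsup>k+1\<^esup>\<close>, and those have no term of index \<open>k\<close> only if \<open>d = 0\<close>, when all lower terms vanish
too. This is what makes the multiplicity drop in the induction for Puiseux series.\<close>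

lemma order_less_if_subleading_zero:
  fixes p :: "complex poly"
  assumes deg: "degree p = Suc k" and sub: "coeff p k = 0" and i: "i \<le> k" "coeff p i \<noteq> 0"
  shows "Polynomial.order d p < Suc k"
proof (rule ccontr)
  assume "\<not> Polynomial.order d p < Suc k"
  have "p \<noteq> 0" using deg by auto
  then have ord: "Polynomial.order d p = Suc k" using order_degree[of p d] deg \<open>\<not> Polynomial.order d p < Suc k\<close> by simp
  obtain q where q: "p = [:-d, 1:] ^ Suc k * q"
    using order_1[of d p] ord by (auto elim: dvdE)
  have "q \<noteq> 0" using q \<open>p \<noteq> 0\<close> by auto
  have "degree p = Suc k + degree q"
    unfolding q using \<open>q \<noteq> 0\<close> by (subst degree_mult_eq) (simp_all add: degree_linear_power del: power_Suc)
  then have "degree q = 0" using deg by simp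
  then obtain b where b: "q = [:b:]" by (auto elim: degree_eq_zeroE)
  have p: "coeff p j = b * (of_nat (Suc k choose j) * (-d) ^ (Suc k - j))" if "j \<le> Suc k" for j
    unfolding q b using coeff_linear_poly_power[of j "Suc k" "-d" "1::complex"] that
    by (simp add: mult.commute[of _ "[:b:]"] del: power_Suc)
  have "b \<noteq> 0" using b \<open>q \<noteq> 0\<close> by auto
  then have "d = 0" using p[of k] sub of_nat_neq_0[of k, where 'a = complex] by simp
  then have "coeff p i = 0" using p[of i] i by simp
  with i show False by simp
qed

section \<open>Roots of polynomials over the Puiseux series\<close>

text \<open>Stated through coefficients, so that the bound also makes sense for the zero series, to which
\<open>puiseux_ord\<close> assigns no meaningful value.\<close>

definition val_ge :: "rat \<Rightarrow> puiseux \<Rightarrow> bool" where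
  "val_ge s p \<longleftrightarrow> (\<forall>q<s. puiseux_coeff p q = 0)"

lemma puiseux_coeff_sum: "puiseux_coeff (\<Sum>i\<in>S. f i) q = (\<Sum>i\<in>S. puiseux_coeff (f i) q)"
  by (induction S rule: infinite_finite_induct)
    (simp_all add: zero_puiseux.rep_eq plus_puiseux.rep_eq)

text \<open>At the sum of two lower bounds for the orders, only one pair of exponents contributes to the
product. Hence leading coefficients are multiplicative, also when the bounds are not attained and
both sides vanish.\<close>

lemma puiseux_coeff_mult_lead:
  assumes "val_ge a x" "val_ge b y"
  shows "puiseux_coeff (x * y) (a + b) = puiseux_coeff x a * puiseux_coeff y b"
proof -
  have "{c. puiseux_coeff x c \<noteq> 0 \<and> puiseux_coeff y (a + b - c) \<noteq> 0} \<subseteq> {a}"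
  proof
    fix c assume "c \<in> {c. puiseux_coeff x c \<noteq> 0 \<and> puiseux_coeff y (a + b - c) \<noteq> 0}"
    then have "\<not> c < a" "\<not> a + b - c < b" using assms by (auto simp: val_ge_def)
    then show "c \<in> {a}" by simp
  qed
  then have "puiseux_coeff (x * y) (a + b) = (\<Sum>c\<in>{a}. puiseux_coeff x c * puiseux_coeff y (a + b - c))"
    unfolding times_puiseux.rep_eq by (intro sum.mono_neutral_left) auto
  then show ?thesis by simp
qed

lemma val_ge_mult:
  assumes "val_ge a x" "val_ge b y"
  shows "val_ge (a + b) (x * y)"
  unfolding val_ge_def
proof (intro allI impI)
  fix q assume q: "q < a + b"
  have "{c. puiseux_coeff x c \<noteq> 0 \<and> puiseux_coeff y (q - c) \<noteq> 0} = {}"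
  proof (rule ccontr)
    assume "\<not> ?thesis"
    then obtain c where "puiseux_coeff x c \<noteq> 0" "puiseux_coeff y (q - c) \<noteq> 0" by blast
    then have "\<not> c < a" "\<not> q - c < b" using assms by (auto simp: val_ge_def)
    with q show False by simp
  qed
  show "puiseux_coeff (x * y) q = 0"
    unfolding times_puiseux.rep_eq \<open>_ = {}\<close> by (rule sum.empty)
qed

lemma lead_power:
  assumes "val_ge a x"
  shows "val_ge (of_nat n * a) (x ^ n)"
    and "puiseux_coeff (x ^ n) (of_nat n * a) = puiseux_coeff x a ^ n"
proof -
  have "val_ge (of_nat n * a) (x ^ n) \<and> puiseux_coeff (x ^ n) (of_nat n * a) = puiseux_coeff x a ^ n"
  proof (induction n)
    case 0
    show ?case by (simp add: val_ge_def one_puiseux.rep_eq)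
  next
    case (Suc n)
    then show ?case using val_ge_mult[OF assms, of "of_nat n * a" "x ^ n"]
        puiseux_coeff_mult_lead[OF assms, of "of_nat n * a" "x ^ n"] by (simp add: algebra_simps)
  qed
  then show "val_ge (of_nat n * a) (x ^ n)"
    "puiseux_coeff (x ^ n) (of_nat n * a) = puiseux_coeff x a ^ n" by simp_all
qed

lemma lead_prod:
  assumes "\<And>i. i \<in> S \<Longrightarrow> val_ge (a i) (x i)"
  shows "val_ge (\<Sum>i\<in>S. a i) (\<Prod>i\<in>S. x i)"
    and "puiseux_coeff (\<Prod>i\<in>S. x i) (\<Sum>i\<in>S. a i) = (\<Prod>i\<in>S. puiseux_coeff (x i) (a i))"
proof -
  have "val_ge (\<Sum>i\<in>S. a i) (\<Prod>i\<in>S. x i) \<and>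
    puiseux_coeff (\<Prod>i\<in>S. x i) (\<Sum>i\<in>S. a i) = (\<Prod>i\<in>S. puiseux_coeff (x i) (a i))"
    using assms
  proof (induction S rule: infinite_finite_induct)
    case (insert i S)
    then show ?case using val_ge_mult[of "a i" "x i"] puiseux_coeff_mult_lead[of "a i" "x i"] by simp
  qed (simp_all add: val_ge_def one_puiseux.rep_eq)
  then show "val_ge (\<Sum>i\<in>S. a i) (\<Prod>i\<in>S. x i)"
    "puiseux_coeff (\<Prod>i\<in>S. x i) (\<Sum>i\<in>S. a i) = (\<Prod>i\<in>S. puiseux_coeff (x i) (a i))" by simp_all
qed

lift_definition puiseux_monom :: "complex \<Rightarrow> rat \<Rightarrow> puiseux" is "\<lambda>c s q. if q = s then c else 0"
proof -
  fix c :: complex and s :: rat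
  obtain a b where ab: "quotient_of s = (a, b)" by (cases "quotient_of s")
  have b: "b > 0" using quotient_of_denom_pos[OF ab] .
  have "of_nat (nat b) * s = of_int a" using quotient_of_div[OF ab] b by simp
  then show "is_puiseux (\<lambda>q. if q = s then c else 0)"
    using b by (intro is_puiseuxI[of "nat b" _ a]) (auto split: if_splits)
qed

lemma puiseux_coeff_monom_mult:
  "puiseux_coeff (puiseux_monom c s * x) q = c * puiseux_coeff x (q - s)"
proof -
  have "puiseux_coeff (puiseux_monom c s * x) q =
    (\<Sum>a\<in>{s}. puiseux_coeff (puiseux_monom c s) a * puiseux_coeff x (q - a))"
    unfolding times_puiseux.rep_eq
    by (intro sum.mono_neutral_left) (auto simp: puiseux_monom.rep_eq split: if_splits)
  then show ?thesis by (simp add: puiseux_monom.rep_eq)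
qed

lemma puiseux_monom_mult: "puiseux_monom c s * puiseux_monom d t = puiseux_monom (c * d) (s + t)"
  by (rule puiseux_eqI) (auto simp: puiseux_coeff_monom_mult puiseux_monom.rep_eq)

lemma puiseux_monom_one: "puiseux_monom 1 0 = 1"
  by (rule puiseux_eqI) (simp add: puiseux_monom.rep_eq one_puiseux.rep_eq)

lemma puiseux_monom_power: "puiseux_monom c s ^ n = puiseux_monom (c ^ n) (of_nat n * s)"
  by (induction n) (simp_all add: puiseux_monom_one puiseux_monom_mult algebra_simps)

lemma puiseux_const_eq_monom: "puiseux_const c = puiseux_monom c 0"
  by (rule puiseux_eqI)
    (auto simp: puiseux_const_def ramify.rep_eq puiseux_monom.rep_eq elim!: Ints_cases)

lemma val_ge_monom: "val_ge s (puiseux_monom c s)"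
  by (simp add: val_ge_def puiseux_monom.rep_eq)

lemma puiseux_ord_eqI:
  assumes "val_ge s x" "puiseux_coeff x s \<noteq> 0"
  shows "puiseux_ord x = s"
  unfolding puiseux_ord_def
proof (rule Least_equality)
  fix q assume "puiseux_coeff x q \<noteq> 0"
  then show "s \<le> q" using assms(1) unfolding val_ge_def by (meson not_less)
qed (rule assms(2))

lemma puiseux_ord_lead:
  assumes "x \<noteq> 0"
  shows "val_ge (puiseux_ord x) x" "puiseux_coeff x (puiseux_ord x) \<noteq> 0"
proof -
  obtain m F where m: "m > 0" and x: "x = ramify m F" by (rule puiseux_ramifyE)
  then have F: "F \<noteq> 0" using assms by auto
  show "val_ge (puiseux_ord x) x"
    unfolding val_ge_def
  proof (intro allI impI, rule ccontr)
    fix q assume q: "q < puiseux_ord x" and "puiseux_coeff x q \<noteq> 0"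
    then have "fls_nth F \<lfloor>of_nat m * q\<rfloor> \<noteq> 0" by (auto simp: x ramify.rep_eq split: if_splits)
    then have "fls_subdegree F \<le> \<lfloor>of_nat m * q\<rfloor>" by (rule fls_subdegree_leI)
    then have "of_int (fls_subdegree F) / of_nat m \<le> q" using m by (simp add: le_floor_iff field_simps)
    with q show False by (simp add: x puiseux_ord_ramify[OF m F])
  qed
  show "puiseux_coeff x (puiseux_ord x) \<noteq> 0"
    using F by (simp add: x puiseux_ord_ramify[OF m F] ramify_nth[OF m])
qed

definition fps_ramify :: "nat \<Rightarrow> complex fps \<Rightarrow> puiseux" where
  "fps_ramify m F = ramify m (fps_to_fls F)"

lemma ring_map_fps_ramify: "m > 0 \<Longrightarrow> ring_map (fps_ramify m)"
  by standard (simp_all add: fps_ramify_def ramify_1 ramify_add ramify_mult fls_times_fps_to_fls)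

lemma fps_ramify_nth: "m > 0 \<Longrightarrow> puiseux_coeff (fps_ramify m F) (of_nat i / of_nat m) = fps_nth F i"
  using ramify_nth[of m "fps_to_fls F" "int i"] by (simp add: fps_ramify_def)

lemma val_ge_fps_ramify:
  assumes "m > 0" "\<And>i. of_nat i < of_nat m * s \<Longrightarrow> fps_nth F i = 0"
  shows "val_ge s (fps_ramify m F)"
  unfolding val_ge_def
proof (intro allI impI)
  fix q assume q: "q < s"
  show "puiseux_coeff (fps_ramify m F) q = 0"
  proof (cases "of_nat m * q \<in> \<int>")
    case True
    then obtain j where j: "of_nat m * q = of_int j" by (auto elim: Ints_cases)
    then have "(of_int j :: rat) < of_nat m * s" using q assms(1) by (metis mult_strict_left_mono of_nat_0_less_iff)
    then have "j \<ge> 0 \<Longrightarrow> fps_nth F (nat j) = 0" using assms(2)[of "nat j"] by simp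
    then show ?thesis by (auto simp: fps_ramify_def ramify.rep_eq j)
  qed (simp add: fps_ramify_def ramify.rep_eq)
qed

text \<open>Finitely many coefficients have a common ramification index, so a polynomial over the valuation
ring is the image of one over \<open>\<complex>[[t\<^bsup>1/m\<^esup>]]\<close>, where Hensel's lemma is at hand.\<close>

lemma integral_puiseux_poly_ramified:
  assumes "\<And>i. val_ge 0 (coeff P i)"
  obtains m Q where "m > 0" "P = map_poly (fps_ramify m) Q"
proof -
  have "\<exists>m Q. m > 0 \<and> P = map_poly (fps_ramify m) Q"
    using assms
  proof (induction P)
    case 0
    show ?case by (intro exI[of _ 1] exI[of _ 0]) simp
  next
    case (pCons a P)
    have "val_ge 0 (coeff P i)" for i using pCons.prems[of "Suc i"] by simp
    then obtain m Q where m: "m > 0" and P: "P = map_poly (fps_ramify m) Q" using pCons.IH by blast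
    obtain k F where k: "k > 0" and a: "a = ramify k F" by (rule puiseux_ramifyE)
    have "fls_nth F j = 0" if "j < 0" for j
    proof -
      have "of_int j / of_nat k < (0::rat)" using that k by (simp add: divide_neg_pos)
      then have "puiseux_coeff a (of_int j / of_nat k) = 0"
        using pCons.prems[of 0] by (simp add: val_ge_def)
      then show ?thesis by (simp add: a ramify_nth[OF k])
    qed
    then have "F = fps_to_fls (fls_regpart F)" by (intro fls_eqI) simp
    then have a': "a = fps_ramify k (fls_regpart F)" by (simp add: fps_ramify_def a)
    have refine: "fps_ramify (i * j) (fps_compose G (fps_X ^ j)) = fps_ramify i G"
      if "i > 0" "j > 0" for i j G
      using that ramify_refine[of i j "fps_to_fls G"]
      by (simp add: fps_ramify_def fls_compose_power_fps_to_fls)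
    have "map_poly (fps_ramify (m * k)) (map_poly (\<lambda>G. fps_compose G (fps_X ^ k)) Q) = P"
      unfolding P by (subst map_poly_map_poly)
        (auto simp: fps_ramify_def[of _ 0] comp_def refine[OF m k])
    moreover have "fps_ramify (m * k) (fps_compose (fls_regpart F) (fps_X ^ m)) = a"
      using refine[OF k m] by (simp add: a' mult.commute)
    ultimately have "pCons a P = map_poly (fps_ramify (m * k))
      (pCons (fps_compose (fls_regpart F) (fps_X ^ m)) (map_poly (\<lambda>G. fps_compose G (fps_X ^ k)) Q))"
      by (subst map_poly_pCons) (auto simp: fps_ramify_def[of _ 0])
    moreover have "m * k > 0" using m k by simp
    ultimately show ?case by blast
  qed
  then show ?thesis using that by blast
qed

text \<open>The Newton--Puiseux theorem, in the form of a Hensel lemma without a multiplicity restriction.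

Let \<open>r\<close> be the multiplicity of \<open>c\<close> in the reduction. Translate by a lift of \<open>c\<close> for which the
coefficient of index \<open>r - 1\<close> vanishes. If all coefficients of smaller index vanish as well, the
lift is a root. Otherwise let \<open>- s\<close> be the slope of the edge of the Newton polygon that ends at
index \<open>r\<close>; substituting \<open>t\<^sup>s z\<close> for the variable and dividing by \<open>t\<^bsup>r s\<^esup>\<close> gives an integral polynomial whose
reduction has degree \<open>r\<close>, no term of index \<open>r - 1\<close>, and some lower term. All its roots therefore
have multiplicity below \<open>r\<close>, and the induction hypothesis applies to any one of them. The resulting
\<open>t\<^sup>s z\<close> has positive order, so the residue \<open>c\<close> is not disturbed.\<close>

theorem puiseux_root_lifts:
  fixes P :: "puiseux poly"
  assumes "\<And>i. val_ge 0 (coeff P i)"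
    and "map_poly (\<lambda>a. puiseux_coeff a 0) P \<noteq> 0"
    and "poly (map_poly (\<lambda>a. puiseux_coeff a 0) P) c = 0"
  shows "\<exists>x. val_ge 0 x \<and> puiseux_coeff x 0 = c \<and> poly P x = 0"
  using assms
proof (induction "Polynomial.order c (map_poly (\<lambda>a. puiseux_coeff a 0) P)" arbitrary: c P
    rule: less_induct)
  case less
  obtain m Q where m: "m > 0" and P: "P = map_poly (fps_ramify m) Q"
    using integral_puiseux_poly_ramified less.prems(1) by blast
  interpret ram: ring_map "fps_ramify m" by (rule ring_map_fps_ramify[OF m])
  have coeff0: "puiseux_coeff (fps_ramify m F) 0 = fps_nth F 0" for F
    using fps_ramify_nth[OF m, of F 0] by simp
  have int: "val_ge 0 (fps_ramify m F)" for F
    by (rule val_ge_fps_ramify[OF m]) simp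
  define Qb where "Qb = map_poly (\<lambda>F. fps_nth F 0) Q"
  have zero: "puiseux_coeff 0 q = 0" for q by (simp add: zero_puiseux.rep_eq)
  have Pb: "map_poly (\<lambda>a. puiseux_coeff a 0) P = Qb"
    by (rule poly_eqI) (simp add: P Qb_def coeff_map_poly zero ram.zero coeff0)
  have Qb0: "Qb \<noteq> 0" "poly Qb c = 0" using less.prems Pb by auto
  then have "Polynomial.order c Qb \<noteq> 0" by (simp add: order_root)
  then obtain k where k: "Polynomial.order c Qb = Suc k" using not0_implies_Suc by blast
  obtain x where x: "fps_nth x 0 = c" "coeff (pcompose Q [:x, 1:]) k = 0"
    using fps_translate_kills_subleading[of Q c k] Qb0(1) k unfolding Qb_def by blast
  define R where "R = pcompose Q [:x, 1:]"
  have "map_poly (\<lambda>F. fps_nth F 0) R = pcompose Qb [:c, 1:]"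
    by (simp add: R_def Qb_def fps_residue.map_poly_translate x(1))
  then have "fps_nth (coeff R i) 0 = coeff (pcompose Qb [:c, 1:]) i" for i
    by (metis coeff_map_poly fps_zero_nth)
  then have R0: "\<And>i. i < Suc k \<Longrightarrow> fps_nth (coeff R i) 0 = 0" "fps_nth (coeff R (Suc k)) 0 \<noteq> 0"
    using translate_order_coeffs[OF Qb0(1), where c = c] k by auto
  have Pshift: "poly P (fps_ramify m x + z) = poly (map_poly (fps_ramify m) R) z" for z
    by (simp add: R_def P ram.map_poly_translate poly_pcompose ram.one add.commute)
  define N where "N = {i. i < Suc k \<and> coeff R i \<noteq> 0}"
  show ?case
  proof (cases "N = {}")
    case True
    then have "coeff R 0 = 0" by (auto simp: N_def)
    then have "poly P (fps_ramify m x) = 0"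
      using Pshift[of 0] by (simp add: poly_0_coeff_0 coeff_map_poly ram.zero)
    then show ?thesis using int x(1) coeff0 by metis
  next
    case False
    \<comment> \<open>The negated slope of the segment from the point of index \<open>i\<close> in the Newton diagram of \<open>R\<close> to
      \<open>(r, 0)\<close>, where \<open>r = k + 1\<close>; the smallest one belongs to the edge of the Newton polygon.\<close>
    define slope where "slope i = (of_nat (subdegree (coeff R i)) / (of_nat m * of_nat (Suc k - i)) :: rat)" for i
    define s where "s = Min (slope ` N)"
    have finN: "finite N" by (simp add: N_def)
    have "s \<in> slope ` N" unfolding s_def using False finN by (intro Min_in) auto
    then obtain i0 where i0: "i0 \<in> N" "s = slope i0" by blast
    have slope_pos: "0 < slope i" if "i \<in> N" for i
    proof -
      have "fps_nth (coeff R i) (subdegree (coeff R i)) \<noteq> 0" "fps_nth (coeff R i) 0 = 0"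
        using that R0(1)[of i] by (auto simp: N_def)
      then have "subdegree (coeff R i) \<noteq> 0" by metis
      then have "subdegree (coeff R i) > 0" by (simp only: neq0_conv)
      then show ?thesis using that m by (simp add: slope_def N_def)
    qed
    have s: "0 < s" using i0 slope_pos by simp
    define P2 where "P2 = smult (puiseux_monom 1 (- of_nat (Suc k) * s))
      (pcompose (map_poly (fps_ramify m) R) [:0, puiseux_monom 1 s:])"
    have cP2: "coeff P2 i = puiseux_monom 1 (of_nat i * s - of_nat (Suc k) * s) * fps_ramify m (coeff R i)" for i
    proof -
      have "coeff P2 i = (puiseux_monom 1 (- of_nat (Suc k) * s) * puiseux_monom 1 s ^ i) *
          fps_ramify m (coeff R i)"
        by (simp add: P2_def coeff_pcompose_linear coeff_map_poly ram.zero mult.assoc)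
      moreover have "puiseux_monom 1 (- of_nat (Suc k) * s) * puiseux_monom 1 s ^ i =
          puiseux_monom 1 (of_nat i * s - of_nat (Suc k) * s)"
        by (simp add: puiseux_monom_power puiseux_monom_mult del: of_nat_Suc)
      ultimately show ?thesis by (simp only:)
    qed
    have nP2: "puiseux_coeff (coeff P2 i) q =
      puiseux_coeff (fps_ramify m (coeff R i)) (q + (of_nat (Suc k) * s - of_nat i * s))" for i q
      by (simp only: cP2 puiseux_coeff_monom_mult) (simp add: algebra_simps)
    \<comment> \<open>No point of the Newton diagram lies below the line of slope \<open>- s\<close> through \<open>(r, 0)\<close>.\<close>
    have val: "val_ge (of_nat (Suc k) * s - of_nat i * s) (fps_ramify m (coeff R i))" for i
    proof (cases "i \<in> N")
      case True
      then have "i < Suc k" by (simp add: N_def)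
      have "s \<le> slope i" unfolding s_def using True finN by simp
      then have "of_nat (Suc k - i) * s \<le> of_nat (subdegree (coeff R i)) / of_nat m"
        using \<open>i < Suc k\<close> m by (simp add: slope_def field_simps del: of_nat_Suc of_nat_diff)
      then have le: "of_nat m * (of_nat (Suc k) * s - of_nat i * s) \<le> of_nat (subdegree (coeff R i))"
        using \<open>i < Suc k\<close> m by (simp add: of_nat_diff field_simps)
      show ?thesis
      proof (rule val_ge_fps_ramify[OF m])
        fix j assume "of_nat j < of_nat m * (of_nat (Suc k) * s - of_nat i * s)"
        with le have "(of_nat j :: rat) < of_nat (subdegree (coeff R i))" by (rule less_le_trans[rotated])
        then have "j < subdegree (coeff R i)" by simp
        then show "fps_nth (coeff R i) j = 0" by (rule nth_less_subdegree_zero)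
      qed
    next
      case notN: False
      show ?thesis
      proof (cases "i < Suc k")
        case True
        then have "coeff R i = 0" using notN by (simp add: N_def)
        then show ?thesis by (simp add: ram.zero val_ge_def zero)
      next
        case False
        then have "of_nat (Suc k) * s \<le> of_nat i * s" using s by (intro mult_right_mono) (simp_all del: of_nat_Suc)
        then show ?thesis using int[of "coeff R i"] by (auto simp: val_ge_def)
      qed
    qed
    have intP2: "val_ge 0 (coeff P2 i)" for i
      using val[of i] unfolding val_ge_def nP2 by auto
    define B where "B = map_poly (\<lambda>a. puiseux_coeff a 0) P2"
    have cB: "coeff B i = puiseux_coeff (fps_ramify m (coeff R i)) (of_nat (Suc k) * s - of_nat i * s)" for i
      by (simp add: B_def coeff_map_poly zero nP2)
    have lead: "coeff B (Suc k) \<noteq> 0" using R0(2) by (simp add: cB coeff0)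
    have above: "coeff B i = 0" if "i > Suc k" for i
    proof -
      have "of_nat (Suc k) * s - of_nat i * s < 0" using that s by (simp del: of_nat_Suc)
      then show ?thesis using int[of "coeff R i"] by (simp add: cB val_ge_def)
    qed
    have deg: "degree B = Suc k" using lead above by (intro antisym degree_le le_degree) auto
    have sub: "coeff B k = 0" using x(2) by (simp add: cB R_def ram.zero zero)
    have "coeff B i0 \<noteq> 0"
    proof -
      have "i0 < Suc k" "coeff R i0 \<noteq> 0" using i0 by (auto simp: N_def)
      then have "of_nat (Suc k) * s - of_nat i0 * s = of_nat (Suc k - i0) * s"
        by (simp add: of_nat_diff left_diff_distrib del: of_nat_Suc)
      also have "\<dots> = of_nat (subdegree (coeff R i0)) / of_nat m"
        using m \<open>i0 < Suc k\<close> by (simp add: i0(2) slope_def del: of_nat_Suc of_nat_diff)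
      finally have "of_nat (Suc k) * s - of_nat i0 * s = of_nat (subdegree (coeff R i0)) / of_nat m" .
      then show ?thesis using \<open>coeff R i0 \<noteq> 0\<close> by (simp add: cB fps_ramify_nth[OF m])
    qed
    moreover have "i0 \<le> k" using i0 by (simp add: N_def)
    ultimately have drop: "Polynomial.order d B < Suc k" for d
      using order_less_if_subleading_zero[OF deg sub] by blast
    obtain d where d: "poly B d = 0"
      using alg_closed_imp_poly_has_root[of B] deg by auto
    have "B \<noteq> 0" using lead by auto
    obtain z where z: "val_ge 0 z" "poly P2 z = 0"
      using less.hyps[OF _ intP2, where c = d] drop[of d] d \<open>B \<noteq> 0\<close> unfolding B_def[symmetric] Pb k by blast
    define y where "y = fps_ramify m x + puiseux_monom 1 s * z"
    have "puiseux_monom 1 (- of_nat (Suc k) * s) * poly P y = 0"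
      using z(2) by (simp add: y_def P2_def Pshift poly_pcompose mult.commute)
    then have "puiseux_monom 1 (of_nat (Suc k) * s) * (puiseux_monom 1 (- of_nat (Suc k) * s) * poly P y) = 0"
      by (metis mult_zero_right)
    then have "poly P y = 0"
      by (simp add: mult.assoc[symmetric] puiseux_monom_mult puiseux_monom_one
          del: of_nat_Suc mult_eq_0_iff)
    moreover have "puiseux_coeff y q = puiseux_coeff (fps_ramify m x) q" if "q \<le> 0" for q
      using z(1) s that by (simp add: y_def plus_puiseux.rep_eq puiseux_coeff_monom_mult val_ge_def)
    then have "val_ge 0 y" "puiseux_coeff y 0 = c"
      using int[of x] coeff0[of x] x(1) by (auto simp: val_ge_def)
    ultimately show ?thesis by blast
  qed
qed

section \<open>Rational approximation and generic points\<close>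

text \<open>Dirichlet's simultaneous approximation gives a denominator \<open>q\<close> with \<open>q w\<close> within \<open>1 / N\<close> of an
integer vector. If \<open>w \<bullet> d = 0\<close> for an integer vector \<open>d\<close>, the pairing of that integer vector with
\<open>d\<close> is an integer smaller than 1 in absolute value, hence zero: the linear equations satisfied by
\<open>w\<close> survive the approximation exactly. Strict inequalities survive because it is close.\<close>

lemma rational_point_preserving_signs:
  fixes w :: "real ^ 'n::finite" and D :: "(real ^ 'n) set"
  assumes fin: "finite D" and int: "\<And>d i. d \<in> D \<Longrightarrow> d $ i \<in> \<int>" and e: "e > 0"
  obtains v :: "rat ^ 'n" where
    "\<And>i. \<bar>real_of_rat (v $ i) - w $ i\<bar> < e"
    "\<And>d. d \<in> D \<Longrightarrow> w \<bullet> d = 0 \<Longrightarrow> (\<chi> i. real_of_rat (v $ i)) \<bullet> d = 0"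
    "\<And>d. d \<in> D \<Longrightarrow> w \<bullet> d > 0 \<Longrightarrow> (\<chi> i. real_of_rat (v $ i)) \<bullet> d > 0"
proof -
  \<comment> \<open>\<open>L\<close> bounds the 1-norms of the vectors in \<open>D\<close>, and \<open>\<delta>\<close> below bounds their positive pairings with
      \<open>w\<close> from below; the precision \<open>1 / N\<close> has to beat both.\<close>
  define L where "L = 1 + (\<Sum>d\<in>D. \<Sum>i\<in>UNIV. \<bar>d $ i\<bar>)"
  have L: "(\<Sum>i\<in>UNIV. \<bar>d $ i\<bar>) \<le> L" if "d \<in> D" for d
    using member_le_sum[OF that, of "\<lambda>d. \<Sum>i\<in>UNIV. \<bar>d $ i\<bar>"] fin by (simp add: L_def sum_nonneg)
  have L0: "L > 0" by (simp add: L_def add_pos_nonneg sum_nonneg)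
  define \<delta> where "\<delta> = Min (insert 1 {w \<bullet> d | d. d \<in> D \<and> w \<bullet> d > 0})"
  have finP: "finite (insert 1 {w \<bullet> d | d. d \<in> D \<and> w \<bullet> d > 0})" using fin by simp
  have \<delta>: "0 < \<delta>" using finP by (auto simp: \<delta>_def)
  have \<delta>': "\<delta> \<le> w \<bullet> d" if "d \<in> D" "w \<bullet> d > 0" for d
    unfolding \<delta>_def using finP that by (intro Min_le) auto
  obtain N :: nat where N: "max (max L (L / \<delta>)) (1 / e) < real N" using reals_Archimedean2 by blast
  have N0: "real N > 0" using N L0 by linarith
  have N1: "L / real N < 1" "L / real N < \<delta>" "1 / real N < e"
    using N N0 \<delta> e by (simp_all add: field_simps)
  obtain f :: "nat \<Rightarrow> 'n" where f: "bij_betw f {..<CARD('n)} UNIV"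
    using ex_bij_betw_nat_finite[of "UNIV :: 'n set"] by (auto simp: atLeast0LessThan)
  obtain q p where q: "0 < q"
    and p: "\<And>j. j < CARD('n) \<Longrightarrow> \<bar>of_int q * (w $ f j) - of_int (p j)\<bar> < 1 / real N"
    by (rule Dirichlet_approx_simult[of N "CARD('n)" "\<lambda>j. w $ f j"]) (use N0 in auto)
  define g where "g = the_inv_into {..<CARD('n)} f"
  have g: "g i < CARD('n)" "f (g i) = i" for i
    using f the_inv_into_into[of f "{..<CARD('n)}" i] f_the_inv_into_f_bij_betw[OF f, of i]
    by (auto simp: g_def bij_betw_def)
  define v :: "rat ^ 'n" where "v = (\<chi> i. of_int (p (g i)) / of_int q)"
  define v' where "v' = (\<chi> i. real_of_rat (v $ i))"
  have v': "v' $ i = of_int (p (g i)) / of_int q" for i by (simp add: v'_def v_def of_rat_divide)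
  have q1: "1 \<le> real_of_int q" using q by simp
  have close: "\<bar>of_int q * (v' $ i - w $ i)\<bar> < 1 / real N" for i
  proof -
    have "of_int q * (v' $ i - w $ i) = - (of_int q * (w $ f (g i)) - of_int (p (g i)))"
      using q by (simp add: v' g field_simps)
    then show ?thesis using p[OF g(1)[of i]] by (simp only: abs_minus_cancel)
  qed
  have dist: "\<bar>v' $ i - w $ i\<bar> < 1 / real N" for i
  proof -
    have "1 * \<bar>v' $ i - w $ i\<bar> \<le> of_int q * \<bar>v' $ i - w $ i\<bar>" using q1 by (intro mult_right_mono) auto
    then show ?thesis using close[of i] q1 by (simp add: abs_mult)
  qed
  have inner_le: "\<bar>u \<bullet> d\<bar> \<le> L / real N" if "d \<in> D" "\<And>i. \<bar>u $ i\<bar> < 1 / real N" for u :: "real ^ 'n" and d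
  proof -
    have "\<bar>u \<bullet> d\<bar> \<le> (\<Sum>i\<in>UNIV. \<bar>u $ i\<bar> * \<bar>d $ i\<bar>)"
      unfolding inner_vec_def by (rule order_trans[OF sum_abs]) (simp add: abs_mult)
    also have "\<dots> \<le> (\<Sum>i\<in>UNIV. 1 / real N * \<bar>d $ i\<bar>)"
      by (intro sum_mono mult_right_mono[OF less_imp_le[OF that(2)] abs_ge_zero])
    also have "\<dots> = 1 / real N * (\<Sum>i\<in>UNIV. \<bar>d $ i\<bar>)" by (simp add: sum_distrib_left)
    also have "\<dots> \<le> 1 / real N * L" using L[OF that(1)] N0 by (intro mult_left_mono) auto
    finally show ?thesis by simp
  qed
  show ?thesis
  proof (rule that[of v])
    fix i show "\<bar>real_of_rat (v $ i) - w $ i\<bar> < e" using dist[of i] N1(3) by (simp add: v'_def)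
  next
    fix d assume d: "d \<in> D" and "w \<bullet> d = 0"
    have "of_int q * (v' \<bullet> d) = (of_int q *\<^sub>R (v' - w)) \<bullet> d"
      using \<open>w \<bullet> d = 0\<close> by (simp add: inner_diff_left)
    also have "\<bar>\<dots>\<bar> \<le> L / real N" using close by (intro inner_le[OF d]) simp
    finally have small: "\<bar>of_int q * (v' \<bullet> d)\<bar> < 1" using N1(1) by simp
    have "of_int q * (v' \<bullet> d) = (\<Sum>i\<in>UNIV. of_int (p (g i)) * (d $ i))"
      using q by (simp add: inner_vec_def v' sum_distrib_left)
    also have "\<dots> \<in> \<int>" using int[OF d] by (intro Ints_sum Ints_mult) auto
    finally have "of_int q * (v' \<bullet> d) = 0" using small Ints_nonzero_abs_less1 by blast
    then show "(\<chi> i. real_of_rat (v $ i)) \<bullet> d = 0" using q by (simp add: v'_def)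
  next
    fix d assume d: "d \<in> D" and pos: "w \<bullet> d > 0"
    have "\<bar>(v' - w) \<bullet> d\<bar> \<le> L / real N" using dist by (intro inner_le[OF d]) simp
    then show "(\<chi> i. real_of_rat (v $ i)) \<bullet> d > 0"
      using \<delta>'[OF d pos] N1(2) by (simp add: v'_def inner_diff_left)
  qed
qed

text \<open>Weights of the form \<open>1, y, y\<^sup>2, \<dots>\<close> separate two exponents unless \<open>y\<close> is a root of the polynomial
with the coordinates of their difference as coefficients. Finitely many pairs exclude finitely many
\<open>y\<close>.\<close>

lemma injective_integer_weight:
  fixes S :: "(nat ^ 'n::finite) set"
  assumes "finite S"
  obtains \<theta> :: "'n \<Rightarrow> nat" where "inj_on (\<lambda>\<alpha>. \<Sum>i\<in>UNIV. \<theta> i * \<alpha> $ i) S"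
proof -
  obtain f :: "'n \<Rightarrow> nat" where f: "inj f"
    using finite_imp_inj_to_nat_seg[of "UNIV :: 'n set"] by auto
  define P where "P = (\<lambda>\<alpha> \<beta>. \<Sum>i\<in>UNIV. monom (int (\<alpha> $ i) - int (\<beta> $ i)) (f i))"
  have P0: "P \<alpha> \<beta> \<noteq> 0" if ne: "\<alpha> \<noteq> \<beta>" for \<alpha> \<beta> :: "nat ^ 'n"
  proof -
    obtain i where i: "\<alpha> $ i \<noteq> \<beta> $ i" using ne by (auto simp: vec_eq_iff)
    have "coeff (P \<alpha> \<beta>) (f i) = (\<Sum>j\<in>UNIV. if j = i then int (\<alpha> $ j) - int (\<beta> $ j) else 0)"
      unfolding P_def coeff_sum using f by (intro sum.cong) (auto simp: inj_eq)
    then have "coeff (P \<alpha> \<beta>) (f i) \<noteq> 0" using i by simp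
    then show ?thesis by auto
  qed
  define Z where "Z = (\<Union>(\<alpha>, \<beta>)\<in>{(\<alpha>, \<beta>). \<alpha> \<in> S \<and> \<beta> \<in> S \<and> \<alpha> \<noteq> \<beta>}. {y. poly (P \<alpha> \<beta>) y = 0})"
  have "finite Z"
    unfolding Z_def using P0
    by (intro finite_UN_I) (auto intro: finite_subset[OF _ finite_cartesian_product[OF assms assms]] poly_roots_finite)
  moreover have "infinite (range int)" by (simp add: range_inj_infinite)
  ultimately obtain y where y: "int y \<notin> Z" by (metis finite_subset image_subsetI)
  have "\<alpha> = \<beta>" if S: "\<alpha> \<in> S" "\<beta> \<in> S"
    and eq: "(\<Sum>i\<in>UNIV. y ^ f i * \<alpha> $ i) = (\<Sum>i\<in>UNIV. y ^ f i * \<beta> $ i)" for \<alpha> \<beta>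
  proof (rule ccontr)
    assume "\<alpha> \<noteq> \<beta>"
    then have "poly (P \<alpha> \<beta>) (int y) \<noteq> 0" using y S by (auto simp: Z_def)
    moreover have "poly (P \<alpha> \<beta>) (int y) =
      int (\<Sum>i\<in>UNIV. y ^ f i * \<alpha> $ i) - int (\<Sum>i\<in>UNIV. y ^ f i * \<beta> $ i)"
      by (simp add: P_def poly_sum poly_monom sum_subtractf algebra_simps)
    ultimately show False using eq by simp
  qed
  then show ?thesis by (intro that[of "\<lambda>i. y ^ f i"] inj_onI) auto
qed

text \<open>Nonzero polynomials do not vanish identically on the torus. Along a curve \<open>z \<mapsto> (z\<^bsup>\<theta> i\<^esup>)\<^sub>i\<close> with
separating weights \<open>\<theta>\<close>, distinct monomials remain distinct, so both sums become nonzero polynomials in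
one variable.\<close>

lemma common_torus_nonzero:
  fixes a :: "nat ^ 'n::finite \<Rightarrow> complex"
  assumes fin: "finite S" "finite T" and ne: "S \<noteq> {}" "T \<noteq> {}"
    and nz: "\<And>\<alpha>. \<alpha> \<in> S \<union> T \<Longrightarrow> a \<alpha> \<noteq> 0"
  obtains c :: "'n \<Rightarrow> complex" where "\<And>i. c i \<noteq> 0"
    "(\<Sum>\<alpha>\<in>S. a \<alpha> * (\<Prod>i\<in>UNIV. c i ^ (\<alpha> $ i))) \<noteq> 0"
    "(\<Sum>\<alpha>\<in>T. a \<alpha> * (\<Prod>i\<in>UNIV. c i ^ (\<alpha> $ i))) \<noteq> 0"
proof -
  obtain \<theta> :: "'n \<Rightarrow> nat" where \<theta>: "inj_on (\<lambda>\<alpha>. \<Sum>i\<in>UNIV. \<theta> i * \<alpha> $ i) (S \<union> T)"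
    using injective_integer_weight[of "S \<union> T"] fin by blast
  define e where "e = (\<lambda>\<alpha>::nat ^ 'n. \<Sum>i\<in>UNIV. \<theta> i * \<alpha> $ i)"
  define p where "p = (\<lambda>R. \<Sum>\<alpha>\<in>R. monom (a \<alpha>) (e \<alpha>))"
  have p0: "p R \<noteq> 0" if R: "finite R" "R \<noteq> {}" "R \<subseteq> S \<union> T" for R
  proof -
    obtain \<alpha> where \<alpha>: "\<alpha> \<in> R" using R(2) by blast
    have "coeff (p R) (e \<alpha>) = (\<Sum>\<beta>\<in>R. if \<beta> = \<alpha> then a \<beta> else 0)"
      unfolding p_def coeff_sum using \<theta> \<alpha> R(3)
      by (intro sum.cong) (auto simp: e_def[symmetric] dest: inj_onD)
    then have "coeff (p R) (e \<alpha>) \<noteq> 0" using R \<alpha> nz by (auto simp: sum.delta)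
    then show ?thesis by auto
  qed
  have "p S * p T * [:0, 1:] \<noteq> 0" using p0[of S] p0[of T] fin ne by simp
  then have "finite {z. poly (p S * p T * [:0, 1:]) z = 0}" by (rule poly_roots_finite)
  then obtain z where "poly (p S * p T * [:0, 1:]) z \<noteq> 0"
    using ex_new_if_finite[OF infinite_UNIV_char_0[where 'a = complex]] by blast
  then have z: "z \<noteq> 0" "poly (p S) z \<noteq> 0" "poly (p T) z \<noteq> 0" by auto
  have "a \<alpha> * (\<Prod>i\<in>UNIV. (z ^ \<theta> i) ^ (\<alpha> $ i)) = poly (monom (a \<alpha>) (e \<alpha>)) z" for \<alpha>
    by (simp add: poly_monom e_def power_sum power_mult)
  then have "(\<Sum>\<alpha>\<in>R. a \<alpha> * (\<Prod>i\<in>UNIV. (z ^ \<theta> i) ^ (\<alpha> $ i))) = poly (p R) z" for R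
    by (simp add: p_def poly_sum)
  then show ?thesis using z by (intro that[of "\<lambda>i. z ^ \<theta> i"]) auto
qed

section \<open>Orders of zeros of a polynomial\<close>

definition minimizers :: "real ^ 'n::finite \<Rightarrow> (nat ^ 'n) set \<Rightarrow> (nat ^ 'n) set" where
  "minimizers w S = {\<alpha> \<in> S. \<forall>\<gamma>\<in>S. pairing w \<alpha> \<le> pairing w \<gamma>}"

definition min_attained_twice :: "real ^ 'n::finite \<Rightarrow> (nat ^ 'n) set \<Rightarrow> bool" where
  "min_attained_twice w S \<longleftrightarrow> (\<exists>\<alpha>\<in>minimizers w S. \<exists>\<beta>\<in>minimizers w S. \<alpha> \<noteq> \<beta>)"

lemma finite_minimizers_nonempty:
  assumes "finite S" "S \<noteq> {}"
  shows "minimizers w S \<noteq> {}"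
  using arg_min_if_finite(1)[OF assms, of "pairing w"] arg_min_least[OF assms, of _ "pairing w"]
  unfolding minimizers_def by blast

lemma closed_min_attained_twice:
  assumes "finite S"
  shows "closed {w. min_attained_twice w S}"
proof -
  have "{w. min_attained_twice w S} = (\<Union>\<alpha>\<in>S. \<Union>\<beta>\<in>S - {\<alpha>}. \<Inter>\<gamma>\<in>S.
      {w. pairing w \<alpha> \<le> pairing w \<gamma>} \<inter> {w. pairing w \<beta> \<le> pairing w \<gamma>})"
    by (auto simp: min_attained_twice_def minimizers_def)
  moreover have "closed {w. pairing w \<alpha> \<le> pairing w \<gamma>}" for \<alpha> \<gamma> :: "nat ^ 'a"
    unfolding pairing_def by (intro closed_Collect_le continuous_intros)
  ultimately show ?thesis
    using assms by (auto intro!: closed_UN closed_INT closed_Int)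
qed

lemma complex_poly_nonzero_root:
  fixes p :: "complex poly"
  assumes "coeff p i \<noteq> 0" "coeff p j \<noteq> 0" "i \<noteq> j"
  obtains d where "d \<noteq> 0" "poly p d = 0"
proof -
  have "p \<noteq> 0" using assms by auto
  then obtain q where q: "p = [:- 0, 1:] ^ Polynomial.order 0 p * q" "\<not> [:- 0, 1:] dvd q"
    using order_decomp by blast
  have p: "p = monom 1 (Polynomial.order 0 p) * q" by (subst q(1)) (simp add: monom_altdef)
  have "degree q \<noteq> 0"
  proof
    assume "degree q = 0"
    then obtain b where b: "q = [:b:]" by (auto elim: degree_eq_zeroE)
    then have "coeff p l = (if l = Polynomial.order 0 p then b else 0)" for l
      by (subst p) (simp add: coeff_monom_mult coeff_pCons split: nat.split)
    with assms show False by (metis (full_types))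
  qed
  then obtain d where d: "poly q d = 0" using alg_closed_imp_poly_has_root[of q] by auto
  then have "d \<noteq> 0" using q(2) by (auto simp: poly_eq_0_iff_dvd)
  moreover have "poly p d = 0" by (subst p) (simp add: d)
  ultimately show ?thesis by (rule that)
qed

lemma puiseux_monom_prod:
  "(\<Prod>i\<in>S. puiseux_monom (c i) (s i)) = puiseux_monom (\<Prod>i\<in>S. c i) (\<Sum>i\<in>S. s i)"
  by (induction S rule: infinite_finite_induct) (simp_all add: puiseux_monom_one puiseux_monom_mult)

definition rat_pairing :: "rat ^ 'n::finite \<Rightarrow> nat ^ 'n \<Rightarrow> rat" where
  "rat_pairing v \<alpha> = (\<Sum>i\<in>UNIV. of_nat (\<alpha> $ i) * v $ i)"

definition real_vec :: "rat ^ 'n::finite \<Rightarrow> real ^ 'n" where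
  "real_vec v = (\<chi> i. real_of_rat (v $ i))"

lemma pairing_real_vec: "pairing (real_vec v) \<alpha> = real_of_rat (rat_pairing v \<alpha>)"
  by (simp add: pairing_def rat_pairing_def real_vec_def of_rat_sum of_rat_mult mult.commute)

text \<open>A unique term of least order cannot be cancelled by the others.\<close>

lemma ord_vec_attains_min_twice:
  assumes fin: "finite (supp g)" and ne: "supp g \<noteq> {}" and x: "x \<in> torus_variety g"
  shows "min_attained_twice (ord_vec x) (supp g)"
proof (rule ccontr)
  assume not: "\<not> ?thesis"
  define v where "v = (\<chi> i. puiseux_ord (x $ i))"
  have ord: "ord_vec x = real_vec v" by (simp add: v_def real_vec_def ord_vec_def)
  obtain \<alpha> where \<alpha>: "\<alpha> \<in> minimizers (ord_vec x) (supp g)"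
    using finite_minimizers_nonempty[OF fin ne] by blast
  define T where "T \<gamma> = puiseux_const (g \<gamma>) * (\<Prod>i\<in>UNIV. (x $ i) ^ (\<gamma> $ i))" for \<gamma>
  have x0: "x $ i \<noteq> 0" for i using x by (simp add: torus_variety_def)
  have eval: "poly_eval g x = 0" using x by (simp add: torus_variety_def)
  have lead: "val_ge (v $ i) (x $ i)" "puiseux_coeff (x $ i) (v $ i) \<noteq> 0" for i
    using puiseux_ord_lead[OF x0[of i]] by (simp_all add: v_def)
  have T: "puiseux_coeff (T \<gamma>) q = g \<gamma> * puiseux_coeff (\<Prod>i\<in>UNIV. (x $ i) ^ (\<gamma> $ i)) q" for \<gamma> q
    by (simp add: T_def puiseux_const_eq_monom puiseux_coeff_monom_mult)
  have T_val: "val_ge (rat_pairing v \<gamma>) (T \<gamma>)" for \<gamma>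
    using lead_prod(1)[of UNIV "\<lambda>i. of_nat (\<gamma> $ i) * v $ i" "\<lambda>i. (x $ i) ^ (\<gamma> $ i)"] lead_power(1)[OF lead(1)]
    by (simp add: val_ge_def T rat_pairing_def)
  have T_lead: "puiseux_coeff (T \<alpha>) (rat_pairing v \<alpha>) \<noteq> 0"
  proof -
    have "puiseux_coeff (\<Prod>i\<in>UNIV. (x $ i) ^ (\<alpha> $ i)) (rat_pairing v \<alpha>) =
      (\<Prod>i\<in>UNIV. puiseux_coeff (x $ i) (v $ i) ^ (\<alpha> $ i))"
      unfolding rat_pairing_def using lead_power[OF lead(1)] by (subst lead_prod(2)) simp_all
    moreover have "g \<alpha> \<noteq> 0" using \<alpha> by (simp add: minimizers_def supp_def)
    ultimately show ?thesis using lead(2) by (simp add: T)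
  qed
  have T_other: "puiseux_coeff (T \<gamma>) (rat_pairing v \<alpha>) = 0" if \<gamma>: "\<gamma> \<in> supp g" "\<gamma> \<noteq> \<alpha>" for \<gamma>
  proof -
    have "\<gamma> \<notin> minimizers (ord_vec x) (supp g)" using not \<alpha> \<gamma> by (auto simp: min_attained_twice_def)
    then obtain \<delta> where "\<delta> \<in> supp g" "pairing (ord_vec x) \<delta> < pairing (ord_vec x) \<gamma>"
      using \<gamma> by (auto simp: minimizers_def not_le)
    then have "pairing (ord_vec x) \<alpha> < pairing (ord_vec x) \<gamma>"
      using \<alpha> by (force simp: minimizers_def)
    then have "rat_pairing v \<alpha> < rat_pairing v \<gamma>" by (simp add: ord pairing_real_vec of_rat_less)
    then show ?thesis using T_val by (simp add: val_ge_def)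
  qed
  have "puiseux_coeff (poly_eval g x) (rat_pairing v \<alpha>) = puiseux_coeff (T \<alpha>) (rat_pairing v \<alpha>)"
  proof -
    have "\<alpha> \<in> supp g" using \<alpha> by (simp add: minimizers_def)
    then have "(\<Sum>\<gamma>\<in>supp g. puiseux_coeff (T \<gamma>) (rat_pairing v \<alpha>)) = puiseux_coeff (T \<alpha>) (rat_pairing v \<alpha>)"
      using T_other fin by (simp add: sum.remove)
    then show ?thesis by (simp add: poly_eval_def T_def[symmetric] puiseux_coeff_sum)
  qed
  then show False using T_lead eval by (simp add: zero_puiseux.rep_eq)
qed

text \<open>All coordinates but one are fixed as \<open>c\<^sub>i t\<^bsup>v\<^sub>i\<^esup>\<close>, the remaining one is \<open>c\<^sub>i t\<^bsup>v\<^sub>i\<^esup> z\<close> with \<open>z\<close> unknown; it is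
one in which two minimizing exponents differ. After division by the least power of \<open>t\<close>, \<open>g\<close>
becomes an integral polynomial in \<open>z\<close>. For generic \<open>c\<close> its reduction has at least two terms, hence a
nonzero root, and a root of order zero lies above it.\<close>

lemma torus_point_with_orders:
  assumes fin: "finite (supp g)" and tw: "min_attained_twice (real_vec v) (supp g)"
  obtains x where "x \<in> torus_variety g" "ord_vec x = real_vec v"
proof -
  define S where "S = supp g"
  obtain \<alpha> \<beta> where \<alpha>: "\<alpha> \<in> minimizers (real_vec v) S" and \<beta>: "\<beta> \<in> minimizers (real_vec v) S"
    and "\<alpha> \<noteq> \<beta>" using tw by (auto simp: min_attained_twice_def S_def)
  obtain i0 where i0: "\<alpha> $ i0 \<noteq> \<beta> $ i0" using \<open>\<alpha> \<noteq> \<beta>\<close> by (auto simp: vec_eq_iff)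
  define \<mu> where "\<mu> = rat_pairing v \<alpha>"
  define e where "e \<gamma> = rat_pairing v \<gamma> - \<mu>" for \<gamma>
  have e0: "0 \<le> e \<gamma>" if "\<gamma> \<in> S" for \<gamma>
    using \<alpha> that by (simp add: minimizers_def e_def \<mu>_def pairing_real_vec of_rat_less_eq)
  have "e \<alpha> = 0" by (simp add: e_def \<mu>_def)
  have "rat_pairing v \<beta> \<le> rat_pairing v \<alpha>"
    using \<alpha> \<beta> by (simp add: minimizers_def pairing_real_vec of_rat_less_eq)
  then have "e \<beta> = 0" using e0[of \<beta>] \<beta> by (simp add: e_def \<mu>_def minimizers_def)
  have \<alpha>\<beta>: "\<alpha> \<in> S" "\<beta> \<in> S" using \<alpha> \<beta> by (auto simp: minimizers_def)
  \<comment> \<open>The minimizing exponents that contribute to \<open>z\<^sup>k\<close> in the reduction; they may cancel for special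
      values of \<open>c\<close>.\<close>
  define M where "M k = {\<gamma> \<in> S. e \<gamma> = 0 \<and> \<gamma> $ i0 = k}" for k
  have finS: "finite S" using fin by (simp add: S_def)
  have finM: "finite (M k)" for k using finS by (simp add: M_def)
  have neM: "M (\<alpha> $ i0) \<noteq> {}" "M (\<beta> $ i0) \<noteq> {}"
    using \<alpha>\<beta> \<open>e \<alpha> = 0\<close> \<open>e \<beta> = 0\<close> by (auto simp: M_def)
  have nzM: "g \<gamma> \<noteq> 0" if "\<gamma> \<in> M k \<union> M l" for \<gamma> k l using that by (auto simp: M_def S_def supp_def)
  obtain c where c: "\<And>i. c i \<noteq> 0"
    "(\<Sum>\<gamma>\<in>M (\<alpha> $ i0). g \<gamma> * (\<Prod>i\<in>UNIV. c i ^ (\<gamma> $ i))) \<noteq> 0"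
    "(\<Sum>\<gamma>\<in>M (\<beta> $ i0). g \<gamma> * (\<Prod>i\<in>UNIV. c i ^ (\<gamma> $ i))) \<noteq> 0"
    by (rule common_torus_nonzero[OF finM finM neM, where a = g]) (use nzM in blast)+
  define G where "G \<gamma> = g \<gamma> * (\<Prod>i\<in>UNIV. c i ^ (\<gamma> $ i))" for \<gamma>
  define P where "P = (\<Sum>\<gamma>\<in>S. monom (puiseux_monom (G \<gamma>) (e \<gamma>)) (\<gamma> $ i0))"
  define X where "X z = (\<chi> i. puiseux_monom (c i) (v $ i) * (if i = i0 then z else 1))" for z
  have eval: "poly_eval g (X z) = puiseux_monom 1 \<mu> * poly P z" for z
  proof -
    have "puiseux_const (g \<gamma>) * (\<Prod>i\<in>UNIV. (X z $ i) ^ (\<gamma> $ i)) =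
      puiseux_monom 1 \<mu> * (puiseux_monom (G \<gamma>) (e \<gamma>) * z ^ (\<gamma> $ i0))" for \<gamma>
    proof -
      have "(\<Prod>i\<in>UNIV. (if i = i0 then z else 1) ^ (\<gamma> $ i)) = (\<Prod>i\<in>UNIV. if i = i0 then z ^ (\<gamma> $ i) else 1)"
        by (intro prod.cong) auto
      then have "(\<Prod>i\<in>UNIV. (if i = i0 then z else 1) ^ (\<gamma> $ i)) = z ^ (\<gamma> $ i0)" by simp
      then have "(\<Prod>i\<in>UNIV. (X z $ i) ^ (\<gamma> $ i)) =
        puiseux_monom (\<Prod>i\<in>UNIV. c i ^ (\<gamma> $ i)) (rat_pairing v \<gamma>) * z ^ (\<gamma> $ i0)"
        by (simp add: X_def power_mult_distrib prod.distrib puiseux_monom_power puiseux_monom_prod rat_pairing_def)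
      then show ?thesis
        by (simp add: puiseux_const_eq_monom puiseux_monom_mult mult.assoc[symmetric] G_def e_def)
    qed
    then show ?thesis
      by (simp add: poly_eval_def P_def S_def poly_sum poly_monom sum_distrib_left)
  qed
  have coeffP: "puiseux_coeff (coeff P k) q = (\<Sum>\<gamma>\<in>S. if \<gamma> $ i0 = k \<and> q = e \<gamma> then G \<gamma> else 0)" for k q
    unfolding P_def coeff_sum puiseux_coeff_sum
    by (intro sum.cong) (auto simp: puiseux_monom.rep_eq zero_puiseux.rep_eq)
  have int: "val_ge 0 (coeff P k)" for k
    unfolding val_ge_def coeffP using e0 by (fastforce intro!: sum.neutral simp: not_le[symmetric])
  define B where "B = map_poly (\<lambda>a. puiseux_coeff a 0) P"
  have "coeff B k = (\<Sum>\<gamma>\<in>M k. G \<gamma>)" for k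
    unfolding B_def M_def using finS
    by (auto simp: coeff_map_poly zero_puiseux.rep_eq coeffP sum.inter_filter[symmetric] intro!: sum.cong)
  then have "coeff B (\<alpha> $ i0) \<noteq> 0" "coeff B (\<beta> $ i0) \<noteq> 0" using c by (simp_all add: G_def)
  then obtain d where d: "d \<noteq> 0" "poly B d = 0" using i0 by (rule complex_poly_nonzero_root)
  have "B \<noteq> 0" using \<open>coeff B (\<alpha> $ i0) \<noteq> 0\<close> by auto
  then obtain z where z: "val_ge 0 z" "puiseux_coeff z 0 = d" "poly P z = 0"
    using puiseux_root_lifts[OF int] d unfolding B_def by blast
  have lead: "val_ge (v $ i) (X z $ i) \<and> puiseux_coeff (X z $ i) (v $ i) \<noteq> 0" for i
    using z d c(1)[of i]
    by (auto simp: X_def val_ge_def puiseux_coeff_monom_mult one_puiseux.rep_eq)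
  then have "puiseux_ord (X z $ i) = v $ i" for i by (intro puiseux_ord_eqI) auto
  then have "ord_vec (X z) = real_vec v" by (simp add: ord_vec_def real_vec_def)
  moreover have "X z $ i \<noteq> 0" for i using lead[of i] by (auto simp: zero_puiseux.rep_eq)
  then have "X z \<in> torus_variety g" by (simp add: torus_variety_def eval z)
  ultimately show ?thesis using that by blast
qed

text \<open>Kapranov's theorem for a hypersurface with constant coefficients. The right-hand side is closed,
being a finite union of polyhedra. These are cut out by rational equations and inequalities, so
their rational points are dense, and each rational point is the order of a point of the
hypersurface.\<close>

theorem closure_ord_torus_variety:
  fixes g :: "'n::finite mfps"
  assumes fin: "finite (supp g)"
  shows "closure (ord_vec ` torus_variety g) = {w. supp g = {} \<or> min_attained_twice w (supp g)}"
    (is "?L = ?R")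
proof
  have "closed ?R" using closed_min_attained_twice[OF fin] by (cases "supp g = {}") auto
  then show "?L \<subseteq> ?R" using ord_vec_attains_min_twice[OF fin] by (intro closure_minimal) auto
  show "?R \<subseteq> ?L"
  proof (intro subsetI, unfold closure_approachable, intro allI impI)
    fix w and \<epsilon> :: real assume w: "w \<in> ?R" and \<epsilon>: "\<epsilon> > 0"
    define diff where "diff = (\<lambda>(\<alpha>, \<beta>). (\<chi> i. real (\<beta> $ i) - real (\<alpha> $ i)) :: real ^ 'n)"
    have diff: "u \<bullet> diff (\<alpha>, \<beta>) = pairing u \<beta> - pairing u \<alpha>" for u \<alpha> \<beta>
      by (simp add: diff_def inner_vec_def pairing_def sum_subtractf algebra_simps)
    define D where "D = diff ` (supp g \<times> supp g)"
    have D: "finite D" "\<And>d i. d \<in> D \<Longrightarrow> d $ i \<in> \<int>" using fin by (auto simp: D_def diff_def)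
    have "0 < \<epsilon> / (2 * real CARD('n))" using \<epsilon> by simp
    then obtain v where v: "\<And>i. \<bar>real_of_rat (v $ i) - w $ i\<bar> < \<epsilon> / (2 * real CARD('n))"
      "\<And>d. d \<in> D \<Longrightarrow> w \<bullet> d = 0 \<Longrightarrow> real_vec v \<bullet> d = 0"
      "\<And>d. d \<in> D \<Longrightarrow> w \<bullet> d > 0 \<Longrightarrow> real_vec v \<bullet> d > 0"
      unfolding real_vec_def using rational_point_preserving_signs[OF D] by metis
    have "dist (real_vec v) w \<le> (\<Sum>i\<in>UNIV. \<bar>real_of_rat (v $ i) - w $ i\<bar>)"
      using norm_le_l1_cart[of "real_vec v - w"] by (simp add: dist_norm real_vec_def)
    also have "\<dots> \<le> (\<Sum>i\<in>(UNIV :: 'n set). \<epsilon> / (2 * real CARD('n)))"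
      using v(1) by (intro sum_mono less_imp_le)
    also have "\<dots> = \<epsilon> / 2" by simp
    finally have close: "dist (real_vec v) w < \<epsilon>" using \<epsilon> by simp
    have min: "\<alpha> \<in> minimizers (real_vec v) (supp g)" if \<alpha>: "\<alpha> \<in> minimizers w (supp g)" for \<alpha>
      unfolding minimizers_def
    proof (intro CollectI conjI ballI)
      show "\<alpha> \<in> supp g" using \<alpha> by (simp add: minimizers_def)
      fix \<gamma> assume "\<gamma> \<in> supp g"
      then have "diff (\<alpha>, \<gamma>) \<in> D" "w \<bullet> diff (\<alpha>, \<gamma>) \<ge> 0"
        using \<alpha> by (auto simp: D_def minimizers_def diff)
      then have "real_vec v \<bullet> diff (\<alpha>, \<gamma>) \<ge> 0" using v(2,3) by (metis less_eq_real_def)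
      then show "pairing (real_vec v) \<alpha> \<le> pairing (real_vec v) \<gamma>" by (simp add: diff)
    qed
    obtain x where "x \<in> torus_variety g" "ord_vec x = real_vec v"
    proof (cases "supp g = {}")
      case True
      define x where "x = (\<chi> i. puiseux_monom 1 (v $ i))"
      have "puiseux_ord (x $ i) = v $ i" "x $ i \<noteq> 0" for i
        using puiseux_ord_eqI[OF val_ge_monom[of "v $ i" 1]]
        by (auto simp: x_def puiseux_monom.rep_eq zero_puiseux.rep_eq dest: arg_cong[of _ _ "\<lambda>p. puiseux_coeff p (v $ i)"])
      then show ?thesis using True
        by (intro that[of x]) (simp_all add: torus_variety_def poly_eval_def ord_vec_def real_vec_def)
    next
      case False
      then have "min_attained_twice (real_vec v) (supp g)"
        using w min by (fastforce simp: min_attained_twice_def)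
      then show ?thesis using torus_point_with_orders[OF fin] that by blast
    qed
    then show "\<exists>y\<in>ord_vec ` torus_variety g. dist y w < \<epsilon>" using close by (metis imageI)
  qed
qed

section \<open>Minimizing exponents on the strata\<close>

lemma minimizers_iff_inf:
  "\<alpha> \<in> S \<Longrightarrow> ereal (pairing w \<alpha>) = (INF \<gamma>\<in>S. ereal (pairing w \<gamma>)) \<longleftrightarrow> \<alpha> \<in> minimizers w S"
proof
  assume S: "\<alpha> \<in> S" and eq: "ereal (pairing w \<alpha>) = (INF \<gamma>\<in>S. ereal (pairing w \<gamma>))"
  have "ereal (pairing w \<alpha>) \<le> ereal (pairing w \<gamma>)" if "\<gamma> \<in> S" for \<gamma>
    unfolding eq using that by (rule INF_lower)
  then show "\<alpha> \<in> minimizers w S" using S by (simp add: minimizers_def)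
next
  assume "\<alpha> \<in> S" "\<alpha> \<in> minimizers w S"
  then show "ereal (pairing w \<alpha>) = (INF \<gamma>\<in>S. ereal (pairing w \<gamma>))"
    by (intro antisym INF_greatest INF_lower) (auto simp: minimizers_def)
qed

lemma trop_hypersurface_loc_iff:
  "w \<in> trop_hypersurface_loc f \<longleftrightarrow> w \<in> U_loc \<and> (supp f = {} \<or> min_attained_twice w (supp f))"
proof -
  have "minimizers w (supp f) \<subseteq> supp f" by (auto simp: minimizers_def)
  then show ?thesis
    using minimizers_iff_inf[of _ "supp f" w]
    unfolding trop_hypersurface_loc_def min_attained_twice_def trop_def by blast
qed

lemma minimizers_supp_nonempty:
  assumes "w \<in> U_loc" "supp f \<noteq> {}"
  shows "minimizers w (supp f) \<noteq> {}"
  using wei_attained[OF assms] minimizers_iff_inf[of _ "supp f" w] unfolding wei_def by (metis empty_iff)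

lemma is_monomial_iff_supp: "is_monomial f \<longleftrightarrow> (\<exists>\<alpha>. supp f = {\<alpha>})"
proof
  assume "\<exists>\<alpha>. supp f = {\<alpha>}"
  then obtain \<alpha> where \<alpha>: "supp f = {\<alpha>}" by blast
  then have "f \<alpha> \<noteq> 0" "\<And>\<beta>. \<beta> \<noteq> \<alpha> \<Longrightarrow> f \<beta> = 0" by (auto simp: supp_def)
  then show "is_monomial f"
    unfolding is_monomial_def by (intro exI[of _ "f \<alpha>"] exI[of _ \<alpha>]) auto
qed (auto simp: is_monomial_def supp_def)

lemma supp_initial_form: "supp (initial_form w f) = minimizers w (supp f)"
proof -
  have "\<alpha> \<in> supp (initial_form w f) \<longleftrightarrow> \<alpha> \<in> supp f \<and> ereal (pairing w \<alpha>) = wei w f" for \<alpha>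
    by (simp add: supp_def initial_form_def)
  moreover have "minimizers w (supp f) \<subseteq> supp f" by (auto simp: minimizers_def)
  ultimately show ?thesis using minimizers_iff_inf[of _ "supp f" w] unfolding wei_def by blast
qed

lemma initial_form_monomial_iff:
  assumes "w \<in> U_loc"
  shows "\<not> is_monomial (initial_form w f) \<longleftrightarrow> w \<in> trop_hypersurface_loc f"
proof (cases "supp f = {}")
  case True
  then show ?thesis
    using assms by (simp add: is_monomial_iff_supp supp_initial_form trop_hypersurface_loc_iff minimizers_def)
next
  case False
  then obtain \<alpha> where \<alpha>: "\<alpha> \<in> minimizers w (supp f)"
    using minimizers_supp_nonempty[OF assms] by blast
  then have "(\<exists>\<beta>. minimizers w (supp f) = {\<beta>}) \<longleftrightarrow> minimizers w (supp f) = {\<alpha>}"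
    by auto
  also have "\<dots> \<longleftrightarrow> (\<forall>\<beta>\<in>minimizers w (supp f). \<beta> = \<alpha>)"
    using \<alpha> by auto
  finally have "(\<exists>\<beta>. minimizers w (supp f) = {\<beta>}) \<longleftrightarrow> (\<forall>\<beta>\<in>minimizers w (supp f). \<beta> = \<alpha>)" .
  with \<alpha> have "\<not> is_monomial (initial_form w f) \<longleftrightarrow> min_attained_twice w (supp f)"
    unfolding is_monomial_iff_supp supp_initial_form min_attained_twice_def by metis
  then show ?thesis using assms False by (simp add: trop_hypersurface_loc_iff)
qed

lemma minimizers_of_subset:
  assumes sub: "X \<subseteq> S" and mem: "minimizers w S \<subseteq> X" and ne: "minimizers w S \<noteq> {}"
  shows "minimizers w X = minimizers w S"
proof
  obtain \<alpha> where \<alpha>: "\<alpha> \<in> minimizers w S" using ne by blast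
  show "minimizers w X \<subseteq> minimizers w S"
  proof
    fix \<beta> assume \<beta>: "\<beta> \<in> minimizers w X"
    then have "pairing w \<beta> \<le> pairing w \<alpha>" using \<alpha> mem by (auto simp: minimizers_def)
    then show "\<beta> \<in> minimizers w S"
      using \<alpha> \<beta> sub unfolding minimizers_def by (auto intro: order_trans)
  qed
  show "minimizers w S \<subseteq> minimizers w X"
    using sub mem unfolding minimizers_def by blast
qed

lemma pairing_forget: "w \<in> U_stratum J \<Longrightarrow> pairing w (forget J \<alpha>) = pairing w \<alpha>"
  unfolding pairing_def by (intro sum.cong) (auto simp: forget_def U_stratum_def)

text \<open>Off \<open>J\<close> the coordinates of \<open>w\<close> are positive, so a projected exponent strictly above another one has
strictly larger weight. Minimizing exponents therefore project to minimal ones.\<close>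

lemma forget_minimizer_in_min_gens:
  assumes w: "w \<in> U_stratum J" and \<alpha>: "\<alpha> \<in> minimizers w (supp f)"
  shows "forget J \<alpha> \<in> min_gens J f"
proof -
  have "p = forget J \<alpha>" if p: "p \<in> forget J ` supp f" "\<forall>i. p $ i \<le> forget J \<alpha> $ i" for p
  proof (rule ccontr)
    assume ne: "p \<noteq> forget J \<alpha>"
    obtain \<beta> where \<beta>: "\<beta> \<in> supp f" "p = forget J \<beta>" using p(1) by blast
    obtain i where i: "p $ i \<noteq> forget J \<alpha> $ i" using ne by (auto simp: vec_eq_iff)
    then have "i \<notin> J" using \<beta>(2) by (auto simp: forget_def)
    then have wi: "0 < w $ i" using w by (simp add: U_stratum_def)
    have w0: "0 \<le> w $ j" for j using w by (cases "j \<in> J") (auto simp: U_stratum_def less_imp_le)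
    have "p $ i < forget J \<alpha> $ i" using i p(2) by (simp add: order.not_eq_order_implies_strict)
    then have "w $ i * real (p $ i) < w $ i * real (forget J \<alpha> $ i)" using wi by simp
    then have "pairing w p < pairing w (forget J \<alpha>)"
      unfolding pairing_def using w0 p(2)
      by (intro sum_strict_mono_ex1) (auto intro: mult_left_mono)
    then have "pairing w \<beta> < pairing w \<alpha>" using w by (simp add: \<beta>(2) pairing_forget)
    then show False using \<alpha> \<beta>(1) by (auto simp: minimizers_def not_le[symmetric])
  qed
  then show ?thesis using \<alpha> by (auto simp: min_gens_eq_minimals minimals_def minimizers_def)
qed

lemma supp_f_tilde:
  "J \<noteq> UNIV \<Longrightarrow> supp (f_tilde J f) = {\<alpha> \<in> supp f. forget J \<alpha> \<in> min_gens J f}"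
  by (auto simp: supp_def f_tilde_def restrict_terms_def fiber_def)

lemma U_stratum_subset: "U_stratum J \<subseteq> U_loc"
  unfolding U_stratum_def U_loc_def by (auto, metis order.refl less_imp_le)

lemma trop_f_tilde_iff:
  assumes w: "w \<in> U_stratum J" and J: "J \<noteq> UNIV"
  shows "w \<in> trop_hypersurface_loc (f_tilde J f) \<longleftrightarrow> w \<in> trop_hypersurface_loc f"
proof -
  have wU: "w \<in> U_loc" using w U_stratum_subset by blast
  have sub: "minimizers w (supp f) \<subseteq> supp (f_tilde J f)"
    using forget_minimizer_in_min_gens[OF w] J by (auto simp: supp_f_tilde minimizers_def)
  have sub': "supp (f_tilde J f) \<subseteq> supp f" using J by (auto simp: supp_f_tilde)
  show ?thesis
  proof (cases "supp f = {}")
    case True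
    then show ?thesis using sub' by (simp add: trop_hypersurface_loc_iff)
  next
    case False
    then obtain \<alpha> where \<alpha>: "\<alpha> \<in> minimizers w (supp f)" using minimizers_supp_nonempty[OF wU] by blast
    then have "minimizers w (supp (f_tilde J f)) = minimizers w (supp f)"
      by (intro minimizers_of_subset[OF sub' sub]) blast
    moreover have "supp (f_tilde J f) \<noteq> {}" using \<alpha> sub by blast
    ultimately show ?thesis using False by (simp add: trop_hypersurface_loc_iff min_attained_twice_def)
  qed
qed

text \<open>All exponents in a fiber have the same weight, since \<open>w\<close> vanishes on \<open>J\<close>. Keeping every fiber
represented keeps the minimum, and keeping two elements of each larger fiber keeps the fact that it
is attained twice.\<close>

lemma trop_f_hat_iff:
  assumes w: "w \<in> U_stratum J" and A: "is_term_choice A"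
  shows "w \<in> trop_hypersurface_loc (f_hat A J f) \<longleftrightarrow> w \<in> trop_hypersurface_loc (f_tilde J f)"
proof (cases "J = UNIV")
  case True
  then show ?thesis by (simp add: f_hat_def f_tilde_def)
next
  case J: False
  define T where "T = supp (f_tilde J f)"
  define H where "H = supp (f_hat A J f)"
  have choice: "A J f b \<subseteq> fiber J f b"
    "is_singleton (fiber J f b) \<or> card (A J f b) = 2" "A J f b \<noteq> {}" if "b \<in> min_gens J f" for b
  proof -
    have *: "if is_singleton (fiber J f b) then A J f b = fiber J f b
      else A J f b \<subseteq> fiber J f b \<and> card (A J f b) = 2"
      using A J that unfolding is_term_choice_def by blast
    then show "A J f b \<subseteq> fiber J f b" "is_singleton (fiber J f b) \<or> card (A J f b) = 2"
      by (auto split: if_splits)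
    show "A J f b \<noteq> {}" using * by (auto split: if_splits simp: is_singleton_def)
  qed
  have fib: "\<alpha> \<in> supp f" "forget J \<alpha> = b" if "b \<in> min_gens J f" "\<alpha> \<in> A J f b" for \<alpha> b
    using choice(1)[OF that(1)] that(2) by (auto simp: fiber_def)
  have "\<alpha> \<in> H \<longleftrightarrow> \<alpha> \<in> supp f \<and> (\<exists>b\<in>min_gens J f. \<alpha> \<in> A J f b)" for \<alpha>
    using J by (simp add: H_def supp_def f_hat_def restrict_terms_def)
  then have H: "\<alpha> \<in> H \<longleftrightarrow> (\<exists>b\<in>min_gens J f. \<alpha> \<in> A J f b)" for \<alpha>
    using fib(1) by blast
  have T: "\<alpha> \<in> T \<longleftrightarrow> \<alpha> \<in> supp f \<and> forget J \<alpha> \<in> min_gens J f" for \<alpha>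
    using J by (simp add: T_def supp_f_tilde)
  have HT: "H \<subseteq> T"
  proof
    fix \<alpha> assume "\<alpha> \<in> H"
    then obtain b where b: "b \<in> min_gens J f" "\<alpha> \<in> A J f b" using H by blast
    then show "\<alpha> \<in> T" using fib[OF b] by (simp add: T)
  qed
  have rep: "\<exists>\<alpha>'\<in>H. forget J \<alpha>' = forget J \<alpha> \<and> pairing w \<alpha>' = pairing w \<alpha>" if \<alpha>: "\<alpha> \<in> T" for \<alpha>
  proof -
    have b: "forget J \<alpha> \<in> min_gens J f" using \<alpha> by (simp add: T)
    obtain \<alpha>' where \<alpha>': "\<alpha>' \<in> A J f (forget J \<alpha>)" using choice(3)[OF b] by blast
    have eq: "forget J \<alpha>' = forget J \<alpha>" using fib(2)[OF b \<alpha>'] .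
    have "pairing w \<alpha>' = pairing w \<alpha>"
      using pairing_forget[OF w, of \<alpha>'] pairing_forget[OF w, of \<alpha>] eq by simp
    then show ?thesis using eq \<alpha>' H b by blast
  qed
  have min_HT: "minimizers w H = minimizers w T \<inter> H"
  proof (intro equalityI subsetI IntI)
    fix \<alpha> assume \<alpha>: "\<alpha> \<in> minimizers w H"
    then show "\<alpha> \<in> H" by (simp add: minimizers_def)
    have "pairing w \<alpha> \<le> pairing w \<gamma>" if \<gamma>: "\<gamma> \<in> T" for \<gamma>
    proof -
      obtain \<gamma>' where "\<gamma>' \<in> H" "pairing w \<gamma>' = pairing w \<gamma>" using rep[OF \<gamma>] by blast
      then show ?thesis using \<alpha> by (auto simp: minimizers_def)
    qed
    then show "\<alpha> \<in> minimizers w T" using \<open>\<alpha> \<in> H\<close> HT by (auto simp: minimizers_def)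
  next
    fix \<alpha> assume "\<alpha> \<in> minimizers w T \<inter> H"
    then show "\<alpha> \<in> minimizers w H" using HT by (auto simp: minimizers_def)
  qed
  have "min_attained_twice w T \<longleftrightarrow> min_attained_twice w H"
  proof
    assume "min_attained_twice w H"
    then show "min_attained_twice w T" by (auto simp: min_attained_twice_def min_HT)
  next
    assume "min_attained_twice w T"
    then obtain \<alpha> \<beta> where \<alpha>\<beta>: "\<alpha> \<in> minimizers w T" "\<beta> \<in> minimizers w T" "\<alpha> \<noteq> \<beta>"
      by (auto simp: min_attained_twice_def)
    then have T\<alpha>\<beta>: "\<alpha> \<in> T" "\<beta> \<in> T" by (auto simp: minimizers_def)
    have same: "\<gamma> \<in> minimizers w T" if "\<gamma> \<in> T" "pairing w \<gamma> = pairing w \<alpha>" for \<gamma>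
      using that \<alpha>\<beta>(1) by (simp add: minimizers_def)
    have eqp: "pairing w \<beta> = pairing w \<alpha>" using \<alpha>\<beta> by (auto simp: minimizers_def intro: antisym)
    obtain \<gamma> \<delta> where "\<gamma> \<in> H" "\<delta> \<in> H" "\<gamma> \<noteq> \<delta>" "pairing w \<gamma> = pairing w \<alpha>" "pairing w \<delta> = pairing w \<alpha>"
    proof (cases "forget J \<alpha> = forget J \<beta>")
      case True
      define b where "b = forget J \<alpha>"
      have b: "b \<in> min_gens J f" using T T\<alpha>\<beta> by (simp add: b_def)
      have "\<alpha> \<in> fiber J f b" "\<beta> \<in> fiber J f b" using T T\<alpha>\<beta> True by (auto simp: fiber_def b_def)
      then have "\<not> is_singleton (fiber J f b)" using \<alpha>\<beta>(3) by (auto simp: is_singleton_def)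
      then have "card (A J f b) = 2" using choice(2)[OF b] by blast
      then obtain \<gamma> \<delta> where \<gamma>\<delta>: "A J f b = {\<gamma>, \<delta>}" "\<gamma> \<noteq> \<delta>" by (auto simp: card_2_iff)
      then have "forget J \<gamma> = b" "forget J \<delta> = b" using fib(2)[OF b] by auto
      then have "pairing w \<gamma> = pairing w \<alpha>" "pairing w \<delta> = pairing w \<alpha>"
        using pairing_forget[OF w, of \<gamma>] pairing_forget[OF w, of \<delta>] pairing_forget[OF w, of \<alpha>]
        by (simp_all add: b_def)
      then show ?thesis using that[of \<gamma> \<delta>] \<gamma>\<delta> H b by auto
    next
      case False
      obtain \<gamma> where \<gamma>: "\<gamma> \<in> H" "forget J \<gamma> = forget J \<alpha>" "pairing w \<gamma> = pairing w \<alpha>"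
        using rep[OF T\<alpha>\<beta>(1)] by blast
      obtain \<delta> where \<delta>: "\<delta> \<in> H" "forget J \<delta> = forget J \<beta>" "pairing w \<delta> = pairing w \<beta>"
        using rep[OF T\<alpha>\<beta>(2)] by blast
      have "\<gamma> \<noteq> \<delta>" using \<gamma>(2) \<delta>(2) False by metis
      then show ?thesis using that[of \<gamma> \<delta>] \<gamma> \<delta> eqp by simp
    qed
    then show "min_attained_twice w H" using same HT unfolding min_attained_twice_def min_HT by blast
  qed
  moreover have "T = {} \<longleftrightarrow> H = {}" using HT rep by blast
  ultimately show ?thesis by (simp add: trop_hypersurface_loc_iff T_def H_def)
qed

lemma origin_in_trop_by_series:
  fixes I :: "'n::finite mfps set"
  assumes "\<forall>f\<in>I. \<not> is_monomial f"
  shows "0 \<in> trop_by_series I"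
proof -
  have min: "minimizers 0 S = S" for S :: "(nat ^ 'n) set"
    by (auto simp: minimizers_def pairing_def)
  have "supp f = {} \<or> min_attained_twice 0 (supp f)" if "f \<in> I" for f
  proof (rule disjCI)
    assume "\<not> min_attained_twice 0 (supp f)"
    then have "\<forall>\<alpha>\<in>supp f. \<forall>\<beta>\<in>supp f. \<alpha> = \<beta>" by (simp add: min_attained_twice_def min)
    moreover have "\<nexists>\<alpha>. supp f = {\<alpha>}" using assms that by (simp add: is_monomial_iff_supp)
    ultimately show "supp f = {}" by (metis is_singletonI' is_singleton_def)
  qed
  then show ?thesis by (simp add: trop_by_series_def trop_hypersurface_loc_iff U_loc_def)
qed

theorem theorem4p6:
  fixes I :: "'n::finite mfps set" and A :: "'n term_choice"
  assumes "ideal I mfps_ring"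
    and "is_term_choice A"
  shows "trop_by_initial_forms I = trop_by_series I
    \<and> trop_by_series I - {0} = trop_by_tilde I - {0}
    \<and> ((\<forall>f\<in>I. \<not> is_monomial f) \<longrightarrow> trop_by_series I = trop_by_tilde I)
    \<and> trop_by_tilde I = trop_by_hat A I
    \<and> trop_by_hat A I = trop_by_ord A I"
proof -
  have "\<zero>\<^bsub>mfps_ring\<^esub> \<in> I"
    using assms(1) by (intro additive_subgroup.zero_closed ideal.axioms(1))
  then have series_U: "trop_by_series I \<subseteq> U_loc"
    unfolding trop_by_series_def by (auto simp: trop_hypersurface_loc_def)
  then have 12: "trop_by_initial_forms I = trop_by_series I"
    using initial_form_monomial_iff unfolding trop_by_initial_forms_def trop_by_series_def by blast
  have 23: "trop_by_series I - {0} = trop_by_tilde I - {0}"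
  proof (rule Set.set_eqI)
    fix w :: "real ^ 'n"
    show "w \<in> trop_by_series I - {0} \<longleftrightarrow> w \<in> trop_by_tilde I - {0}"
    proof (cases "w \<in> U_loc \<and> w \<noteq> 0")
      case True
      define J where "J = {i. w $ i = 0}"
      have stratum: "w \<in> U_stratum K \<longleftrightarrow> K = J" for K
        using True by (force simp: U_stratum_def U_loc_def J_def less_le)
      have "J \<noteq> UNIV" using True by (auto simp: J_def vec_eq_iff)
      then have "w \<in> trop_hypersurface_loc (f_tilde J f) \<longleftrightarrow> w \<in> trop_hypersurface_loc f" for f
        using stratum by (intro trop_f_tilde_iff) auto
      then show ?thesis using stratum True by (auto simp: trop_by_series_def trop_by_tilde_def)
    next
      case False
      have "trop_by_tilde I \<subseteq> U_loc" using U_stratum_subset unfolding trop_by_tilde_def by blast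
      then show ?thesis using False series_U by auto
    qed
  qed
  have 34: "trop_by_tilde I = trop_by_hat A I"
    using trop_f_hat_iff[OF _ assms(2)] unfolding trop_by_tilde_def trop_by_hat_def by blast
  have "w \<in> closure (ord_vec ` torus_variety (f_hat A J f)) \<longleftrightarrow> w \<in> trop_hypersurface_loc (f_hat A J f)"
    if "w \<in> U_stratum J" for w J f
    using that U_stratum_subset[of J]
    by (auto simp: trop_hypersurface_loc_iff closure_ord_torus_variety[OF finite_supp_f_hat[OF assms(2)]])
  then have 45: "trop_by_hat A I = trop_by_ord A I"
    unfolding trop_by_hat_def trop_by_ord_def by blast
  have "trop_by_series I = trop_by_tilde I" if "\<forall>f\<in>I. \<not> is_monomial f"
    using 23 origin_in_trop_by_series[OF that] origin_in_trop_by_tilde[of I] by blast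
  with 12 23 34 45 show ?thesis by blast
qed

end
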